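(* Let $(X,\mathcal A,\mu,T)$ be a conservative ergodic infinite measure preserving system (as in the context) satisfying properties (P1) and (P2) stated in the context. Let $N_1,\dots,N_k$ be Poisson $T$-point processes, of respective intensities $\alpha_1\mu,\dots,\alpha_k\mu$, defined on the same ergodic system $(\Omega,\mathscr F,\mathbb P,S)$. If these processes are mutually ($T$-)dissociated, then they are independent.
   Context: Setting. $X$ is a complete separable metric space with Borel $\sigma$-algebra $\mathcal A$; $\mu$ is a measure on $(X,\mathcal A)$ that is boundedly finite (finite on bounded Borel sets), with $\mu(X)=\infty$; $T:X\to X$ is invertible and preserves $\mu$, and $(X,\mathcal A,\mu,T)$ is conservative and ergodic. Put $\mathcal A_f=\{A\in\mathcal A: 0<\mu(A)<\infty\}$. $X^*$ is the set of boundedly finite simple counting measures $\xi=\sum_{i\in I}\delta_{x_i}$ ($I$ at most countable, $x_i\ne x_j$ for $i\neq j$), identified with the corresponding sets of points, and $\mathcal A^*$ is the $\sigma$-algebra on $X^*$ generated by the maps $\xi\mapsto \xi(A)$, $A$ bounded Borel. $T$-point process. $(\Omega,\mathscr F,\mathbb P)$ is a probability space and $S$ an invertible measure preserving transformation of it. A $T$-point process defined on $(\Omega,\mathscr F,\mathbb P,S)$ is a measurable map $N:\Omega\to X^*$ such that (i) for each $A\in\mathcal A$ with $\mu(A)=0$, $N(\omega)(A)=0$ for $\mathbb P$-a.e. $\omega$; (ii) for $\mathbb P$-a.e. $\omega$, for all $A\in\mathcal A$, $N(S\omega)(A)=N(\omega)(T^{-1}A)$. Two $T$-point processes $N,N'$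 on $(\Omega,\mathscr F,\mathbb P,S)$ are ($T$-)dissociated if for $\mathbb P$-a.e. $\omega$, for all $k\in\mathbb Z$, $N(\omega)\cap N'(S^k\omega)=\emptyset$ (as sets of points). Poisson. $N$ is a Poisson point process of intensity $\alpha\mu$ if for all $k\ge 1$ and mutually disjoint $A_1,\dots,A_k\in\mathcal A_f$, the variables $N(A_1),\dots,N(A_k)$ are independent and Poisson distributed with parameters $\alpha\mu(A_1),\dots,\alpha\mu(A_k)$. A Poisson $T$-point process is a $T$-point process that is a Poisson point process. Properties (P1), (P2). For $n\ge1$, let $\mathscr P_n$ be the set of partitions of $\{1,\dots,n\}$. For $\pi\in\mathscr P_n$ and $\kappa=(k_i)_{1\le i\le n}$ a family of integers, $m_\pi^\kappa$ is the measure on $X^n$ with $m_\pi^\kappa(A_1\times\cdots\times A_n)=\prod_{P\in\pi}\mu\left(\bigcap_{i\in P}T^{-k_i}A_i\right)$. $\kappa$ is $\pi$-compatible if $k_i=0$ whenever $i$ is the smallest element of an atom of $\pi$. (P1): for each $n\ge1$, the product system $(X^n,\mathcal A^{\otimes n},\mu^{\otimes n},T^{\times n})$ is ergodic. (P2): for each $n\ge1$, if $\sigma$ is a boundedly finite, $T^{\times n}$-invariant measure on $X^n$ whose marginals are absolutely continuous with respect to $\mu$, then $\sigma$ is conservative and its ergodic components are all (up to positive multiplicative constants) of the form $m_\pi^\kappa$ for some $\pi\in\mathscr P_n$ and some $\pi$-compatible family $\kappa$. *)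

theory Defs
  imports "HOL-Probability.Probability"
begin

section \<open>Measure preserving systems\<close>

text \<open>The transformation is a total function on the type, but only its restriction to \<open>A\<close>
  (the space of the measure in question) matters, so the inverse is taken relative to \<open>A\<close>.\<close>

definition int_iterate :: "'b set \<Rightarrow> ('b \<Rightarrow> 'b) \<Rightarrow> int \<Rightarrow> 'b \<Rightarrow> 'b" where
  "int_iterate A f k = (if 0 \<le> k then f ^^ nat k else inv_into A f ^^ nat (- k))"

definition preserves :: "'b measure \<Rightarrow> ('b \<Rightarrow> 'b) \<Rightarrow> bool" where
  "preserves M f \<longleftrightarrow> f \<in> measurable M M \<and> distr M M f = M"

definition invertible_mpt :: "'b measure \<Rightarrow> ('b \<Rightarrow> 'b) \<Rightarrow> bool" where
  "invertible_mpt M f \<longleftrightarrow>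
     preserves M f \<and> bij_betw f (space M) (space M) \<and> inv_into (space M) f \<in> measurable M M"

definition ergodic :: "'b measure \<Rightarrow> ('b \<Rightarrow> 'b) \<Rightarrow> bool" where
  "ergodic M f \<longleftrightarrow>
     (\<forall>A\<in>sets M. f -` A \<inter> space M = A \<longrightarrow> A \<in> null_sets M \<or> space M - A \<in> null_sets M)"

text \<open>Conservativity: every wandering set is null.\<close>

definition conservative :: "'b measure \<Rightarrow> ('b \<Rightarrow> 'b) \<Rightarrow> bool" where
  "conservative M f \<longleftrightarrow>
     (\<forall>W\<in>sets M. (\<forall>k\<ge>1. W \<inter> (f ^^ k) -` W = {}) \<longrightarrow> W \<in> null_sets M)"

definition boundedly_finite :: "'a::metric_space measure \<Rightarrow> bool" where
  "boundedly_finite M \<longleftrightarrow> (\<forall>A\<in>sets M. bounded A \<longrightarrow> emeasure M A < \<infinity>)"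

section \<open>Cartesian powers\<close>

text \<open>\<open>X\<^sup>n\<close> is the set of extensional functions on \<open>{1..n}\<close>. As \<open>X\<close> is second countable, the
  product \<open>\<sigma>\<close>-algebra below is also the Borel \<open>\<sigma>\<close>-algebra of \<open>X\<^sup>n\<close>.\<close>

definition power_algebra :: "nat \<Rightarrow> (nat \<Rightarrow> 'a::topological_space) measure" where
  "power_algebra n = PiM {1..n} (\<lambda>_. borel)"

definition power_map :: "nat \<Rightarrow> ('a \<Rightarrow> 'a) \<Rightarrow> (nat \<Rightarrow> 'a) \<Rightarrow> (nat \<Rightarrow> 'a)" where
  "power_map n T x = (\<lambda>i\<in>{1..n}. T (x i))"

text \<open>A subset of \<open>X\<^sup>n\<close> is bounded for the product metric iff all its projections are bounded.\<close>

definition boundedly_finite_power :: "nat \<Rightarrow> (nat \<Rightarrow> 'a::metric_space) measure \<Rightarrow> bool" where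
  "boundedly_finite_power n \<sigma> \<longleftrightarrow>
     (\<forall>A\<in>sets \<sigma>. (\<forall>i\<in>{1..n}. bounded ((\<lambda>x. x i) ` A)) \<longrightarrow> emeasure \<sigma> A < \<infinity>)"

section \<open>Properties (P1) and (P2)\<close>

definition property_P1 :: "'a::polish_space measure \<Rightarrow> ('a \<Rightarrow> 'a) \<Rightarrow> bool" where
  "property_P1 \<mu> T \<longleftrightarrow> (\<forall>n\<ge>1. ergodic (PiM {1..n} (\<lambda>_. \<mu>)) (power_map n T))"

definition compatible :: "nat set set \<Rightarrow> (nat \<Rightarrow> int) \<Rightarrow> bool" where
  "compatible \<pi> \<kappa> \<longleftrightarrow> (\<forall>Q\<in>\<pi>. \<kappa> (Min Q) = 0)"

text \<open>\<open>is_graph_measure \<mu> T n \<pi> \<kappa> m\<close> states that \<open>m\<close> is the measure \<open>m\<^sub>\<pi>\<^sup>\<kappa>\<close> on \<open>X\<^sup>n\<close>, which is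
  determined by its values on product sets. The preimage under \<open>T\<close> to the power \<open>\<kappa> i\<close> is the
  set \<open>T\<close> to the power \<open>- \<kappa> i\<close> of \<open>A i\<close>.\<close>

definition is_graph_measure ::
  "'a::polish_space measure \<Rightarrow> ('a \<Rightarrow> 'a) \<Rightarrow> nat \<Rightarrow> nat set set \<Rightarrow> (nat \<Rightarrow> int) \<Rightarrow> (nat \<Rightarrow> 'a) measure \<Rightarrow> bool" where
  "is_graph_measure \<mu> T n \<pi> \<kappa> m \<longleftrightarrow>
     sets m = sets (power_algebra n) \<and>
     (\<forall>A. (\<forall>i\<in>{1..n}. A i \<in> sets borel) \<longrightarrow>
        emeasure m (PiE {1..n} A) =
          (\<Prod>Q\<in>\<pi>. emeasure \<mu> (\<Inter>i\<in>Q. int_iterate UNIV T (\<kappa> i) -` A i)))"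

text \<open>The set of all measures on a measurable space, with the \<open>\<sigma>\<close>-algebra generated by the
  evaluations \<open>\<nu> \<mapsto> \<nu>(A)\<close>.\<close>

definition measures_algebra :: "'b measure \<Rightarrow> 'b measure measure" where
  "measures_algebra M =
     sigma {\<nu>. sets \<nu> = sets M}
       {{\<nu>. sets \<nu> = sets M \<and> emeasure \<nu> A \<in> B} | A B. A \<in> sets M \<and> B \<in> sets borel}"

text \<open>An ergodic decomposition of an invariant measure \<open>\<sigma>\<close> on \<open>X\<^sup>n\<close> is a \<open>\<sigma>\<close>-finite measure \<open>\<rho>\<close>
  carried by the non-zero, boundedly finite, invariant and ergodic measures, with barycentre \<open>\<sigma>\<close>.
  The ergodic components of \<open>\<sigma>\<close> are \<open>\<rho>\<close>-almost all measures \<open>\<nu>\<close>. They are unique only up to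
  positive multiplicative constants and \<open>\<rho>\<close>-null sets.\<close>

definition ergodic_decomposition ::
  "nat \<Rightarrow> ('a::polish_space \<Rightarrow> 'a) \<Rightarrow> (nat \<Rightarrow> 'a) measure \<Rightarrow> (nat \<Rightarrow> 'a) measure measure \<Rightarrow> bool" where
  "ergodic_decomposition n T \<sigma> \<rho> \<longleftrightarrow>
     sets \<rho> = sets (measures_algebra (power_algebra n)) \<and> sigma_finite_measure \<rho> \<and>
     (AE \<nu> in \<rho>. emeasure \<nu> (space \<nu>) \<noteq> 0 \<and> boundedly_finite_power n \<nu> \<and>
        preserves \<nu> (power_map n T) \<and> ergodic \<nu> (power_map n T)) \<and>
     (\<forall>A\<in>sets (power_algebra n). emeasure \<sigma> A = (\<integral>\<^sup>+\<nu>. emeasure \<nu> A \<partial>\<rho>))"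

text \<open>Since ergodic decompositions are essentially unique, ``the ergodic components of \<open>\<sigma>\<close>'' may
  be read off from any one of them.\<close>

definition property_P2 :: "'a::polish_space measure \<Rightarrow> ('a \<Rightarrow> 'a) \<Rightarrow> bool" where
  "property_P2 \<mu> T \<longleftrightarrow>
     (\<forall>n\<ge>1. \<forall>\<sigma>.
        sets \<sigma> = sets (power_algebra n) \<and> boundedly_finite_power n \<sigma> \<and>
        preserves \<sigma> (power_map n T) \<and>
        (\<forall>i\<in>{1..n}. absolutely_continuous \<mu> (distr \<sigma> borel (\<lambda>x. x i)))
        \<longrightarrow> conservative \<sigma> (power_map n T) \<and>
            (\<exists>\<rho>. ergodic_decomposition n T \<sigma> \<rho> \<and>
               (AE \<nu> in \<rho>. \<exists>\<pi> \<kappa> m (c::real). partition_on {1..n} \<pi> \<and> compatible \<pi> \<kappa> \<and>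
                  is_graph_measure \<mu> T n \<pi> \<kappa> m \<and> 0 < c \<and> \<nu> = scale_measure (ennreal c) m)))"

section \<open>Point processes\<close>

text \<open>A boundedly finite simple counting measure is identified with its set of atoms, which is a
  set having finitely many points in each bounded set (such a set is automatically countable).
  \<open>point_count \<xi> A\<close> is the value \<open>\<xi>(A)\<close> of the counting measure.\<close>

definition configurations :: "'a::metric_space set set" where
  "configurations = {\<xi>. \<forall>B. bounded B \<longrightarrow> finite (\<xi> \<inter> B)}"

definition point_count :: "'a set \<Rightarrow> 'a set \<Rightarrow> ennreal" where
  "point_count \<xi> A = emeasure (count_space UNIV) (\<xi> \<inter> A)"

definition configuration_algebra :: "'a::metric_space set measure" where
  "configuration_algebra =
     sigma configurations
       {{\<xi>\<in>configurations. point_count \<xi> A \<in> B} | A B.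
          A \<in> sets borel \<and> bounded A \<and> B \<in> sets borel}"

definition T_point_process ::
  "'a::polish_space measure \<Rightarrow> ('a \<Rightarrow> 'a) \<Rightarrow> 'w measure \<Rightarrow> ('w \<Rightarrow> 'w) \<Rightarrow> ('w \<Rightarrow> 'a set) \<Rightarrow> bool" where
  "T_point_process \<mu> T P S N \<longleftrightarrow>
     N \<in> measurable P configuration_algebra \<and>
     (\<forall>A\<in>sets borel. emeasure \<mu> A = 0 \<longrightarrow> (AE \<omega> in P. point_count (N \<omega>) A = 0)) \<and>
     (AE \<omega> in P. \<forall>A\<in>sets borel. point_count (N (S \<omega>)) A = point_count (N \<omega>) (T -` A))"

definition dissociated ::
  "'w measure \<Rightarrow> ('w \<Rightarrow> 'w) \<Rightarrow> ('w \<Rightarrow> 'a set) \<Rightarrow> ('w \<Rightarrow> 'a set) \<Rightarrow> bool" where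
  "dissociated P S N N' \<longleftrightarrow>
     (AE \<omega> in P. \<forall>k::int. N \<omega> \<inter> N' (int_iterate (space P) S k \<omega>) = {})"

definition poisson_process ::
  "'a::polish_space measure \<Rightarrow> real \<Rightarrow> 'w measure \<Rightarrow> ('w \<Rightarrow> 'a set) \<Rightarrow> bool" where
  "poisson_process \<mu> \<alpha> P N \<longleftrightarrow>
     (\<forall>k\<ge>1. \<forall>A :: nat \<Rightarrow> 'a set.
        (\<forall>i\<in>{1..k}. A i \<in> sets borel \<and> 0 < emeasure \<mu> (A i) \<and> emeasure \<mu> (A i) < \<infinity>) \<and>
        disjoint_family_on A {1..k} \<longrightarrow>
          prob_space.indep_vars P (\<lambda>_. borel) (\<lambda>i \<omega>. point_count (N \<omega>) (A i)) {1..k} \<and>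
          (\<forall>i\<in>{1..k}. distr P borel (\<lambda>\<omega>. point_count (N \<omega>) (A i)) =
             distr (measure_pmf (poisson_pmf (\<alpha> * measure \<mu> (A i)))) borel of_nat))"

end

theory Submission
  imports Defs
begin

text \<open>
  The law of a family of point processes is determined by the probabilities that the processes leave
  prescribed bounded sets empty, because the void events are an intersection-stable generator of the
  configuration algebra (\<open>sets_configuration_algebra_void\<close>). The processes are therefore independent as
  soon as the joint void probabilities are
  \[ P(N_1 \cap B_1 = \emptyset, \dots, N_k \cap B_k = \emptyset) = \exp(-(\alpha_1 \mu(B_1) + \dots + \alpha_k \mu(B_k))) \]
  (\<open>prob_void\<close>). By inclusion and exclusion this follows once the mixed factorial moments
  of the processes are those of independent Poisson processes (\<open>nn_integral_fact_count_eq\<close>). Fix a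
  colouring \<open>c\<close> of \<open>{1..n}\<close> by the indices of the processes.

  Consider the measure on \<open>X\<^sup>n\<close> that gives the expected number of tuples whose \<open>i\<close>-th entry is a point
  of the process \<open>c i\<close> and whose entries lie on different \<open>T\<close>-orbits. It satisfies the assumptions of
  property (P2). Its ergodic components do not charge tuples with two entries on a common orbit, so that
  no component can be a graph measure with a nontrivial block (\<open>graph_measure_dichotomy\<close>), and the
  only remaining component is the product measure. Hence the measure is a multiple of the product
  measure (\<open>moment_measure_proportional\<close>).

  Dropping the tuples with entries on a common orbit costs nothing: for different processes this is
  dissociation, and for a single process it follows from the Poisson property, as \<open>\<mu>\<close> has no atoms
  (\<open>AE_same_colour\<close>). The multiples of the product measure are thus the mixed factorial moment measures.

  The constants are found by a law of large numbers. On a ball of large mass \<open>M\<close> each process has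
  \<open>\<alpha> M\<close> points up to an error of order \<open>sqrt M\<close>, so appending an index of colour \<open>d\<close> multiplies the
  constant by \<open>\<alpha> d\<close> (\<open>coefficient_recursion\<close>). Thus the constant is the product of the intensities.
\<close>

section \<open>Void events generate the configuration algebra\<close>

definition void_events :: "'a::metric_space set set set" where
  "void_events = {{\<xi>\<in>configurations. \<xi> \<inter> B = {}} | B. B \<in> sets borel \<and> bounded B}"

lemma finite_point_count:
  assumes "\<xi> \<in> configurations" "bounded B"
  shows "finite (\<xi> \<inter> B)" "point_count \<xi> B = of_nat (card (\<xi> \<inter> B))"
  using assms by (auto simp: configurations_def point_count_def)

lemma space_configuration_algebra [simp]: "space configuration_algebra = configurations"
  unfolding configuration_algebra_def by (rule space_measure_of) auto

lemma measurable_point_count: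
  assumes "A \<in> sets borel" "bounded A"
  shows "(\<lambda>\<xi>. point_count \<xi> A) \<in> borel_measurable configuration_algebra"
proof (rule measurableI)
  fix B :: "ennreal set" assume B: "B \<in> sets borel"
  have "(\<lambda>\<xi>. point_count \<xi> A) -` B \<inter> space configuration_algebra
      = {\<xi>\<in>configurations. point_count \<xi> A \<in> B}" by auto
  also have "\<dots> \<in> sets configuration_algebra"
    unfolding configuration_algebra_def using assms B
    by (subst sets_measure_of) (auto intro!: sigma_sets.Basic)
  finally show "(\<lambda>\<xi>. point_count \<xi> A) -` B \<inter> space configuration_algebra \<in> sets configuration_algebra" .
qed simp

lemma finite_separated:
  fixes F :: "'a::metric_space set"
  assumes "finite F"
  obtains \<delta> where "\<delta> > 0" "\<And>x y. x \<in> F \<Longrightarrow> y \<in> F \<Longrightarrow> x \<noteq> y \<Longrightarrow> \<delta> \<le> dist x y"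
proof -
  let ?S = "insert 1 ((\<lambda>(x, y). dist x y) ` (F \<times> F - Id))"
  have fin: "finite ?S" using assms by auto
  have "Min ?S \<in> ?S" using fin by (intro Min_in) auto
  then have "Min ?S > 0" by auto
  moreover have "Min ?S \<le> dist x y" if "x \<in> F" "y \<in> F" "x \<noteq> y" for x y
    using fin that by (intro Min_le) (auto intro!: image_eqI[of _ _ "(x, y)"])
  ultimately show ?thesis using that by blast
qed

text \<open>The void events determine a configuration: on a bounded set \<open>A\<close> the configuration is finite, so a
  partition of \<open>A\<close> into sufficiently small cells separates its points, and then the number of points
  is the number of cells that are not void. As any partition can only undercount, \<open>\<xi>(A)\<close> is the
  supremum of these cell counts over a sequence of partitions with mesh tending to zero.\<close>

lemma sets_configuration_algebra_void:
  "sets (configuration_algebra :: 'a::{metric_space, second_countable_topology} set measure)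
    = sigma_sets configurations void_events"
proof (rule antisym)
  define V :: "'a set measure" where "V = sigma configurations void_events"
  have sub: "void_events \<subseteq> Pow (configurations :: 'a set set)" by (auto simp: void_events_def)
  have spV: "space V = configurations" and seV: "sets V = sigma_sets configurations void_events"
    using sub by (auto simp: V_def)
  have void: "{\<xi>\<in>configurations. \<xi> \<inter> B \<noteq> {}} \<in> sets V" if "B \<in> sets borel" "bounded B" for B :: "'a set"
  proof -
    have "{\<xi>\<in>configurations. \<xi> \<inter> B = {}} \<in> sets V"
      unfolding seV void_events_def using that by (intro sigma_sets.Basic) auto
    then have "space V - {\<xi>\<in>configurations. \<xi> \<inter> B = {}} \<in> sets V" by blast
    then show ?thesis unfolding spV by (rule back_subst[of "\<lambda>x. x \<in> sets V"]) auto
  qed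
  obtain D :: "'a set" where D: "countable D" "\<And>X. open X \<Longrightarrow> X \<noteq> {} \<Longrightarrow> \<exists>d\<in>D. d \<in> X"
    using countable_dense_setE by blast
  have Dne: "D \<noteq> {}" using D(2)[of UNIV] by auto
  define d where "d = from_nat_into D"
  have ex: "\<exists>j. dist x (d j) < e" if "e > 0" for x e
  proof -
    obtain y where "y \<in> D" "y \<in> ball x e" using D(2)[of "ball x e"] \<open>e > 0\<close> by auto
    moreover from \<open>y \<in> D\<close> obtain j where "y = d j"
      unfolding d_def using from_nat_into_surj[OF D(1)] by metis
    ultimately show ?thesis by auto
  qed
  \<comment> \<open>A point belongs to the cell of the first dense point that is closer than \<open>1 / Suc n\<close>.\<close>
  define idx where "idx n x = (LEAST j. dist x (d j) < 1 / Suc n)" for n x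
  have idx: "dist x (d (idx n x)) < 1 / Suc n" for n x
    unfolding idx_def by (rule LeastI_ex, rule ex) simp
  have idx_meas: "idx n \<in> measurable borel (count_space UNIV)" for n
    unfolding idx_def by measurable
  have pc: "(\<lambda>\<xi>. point_count \<xi> A) \<in> borel_measurable V"
    if A: "A \<in> sets borel" "bounded A" for A :: "'a set"
  proof -
    define cell where "cell n j = A \<inter> idx n -` {j}" for n j
    have cell: "cell n j \<in> sets borel" "bounded (cell n j)" for n j
      using A measurable_sets[OF idx_meas, of "{j}" n]
      by (auto simp: cell_def intro: bounded_subset)
    define h where "h n \<xi> = (\<Sum>j. indicator {\<xi>\<in>configurations. \<xi> \<inter> cell n j \<noteq> {}} \<xi> :: ennreal)" for n \<xi>
    have h_meas: "h n \<in> borel_measurable V" for n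
      unfolding h_def using void[OF cell] by measurable
    have h_eq: "h n \<xi> = of_nat (card (idx n ` (\<xi> \<inter> A)))" if \<xi>: "\<xi> \<in> configurations" for n \<xi>
    proof -
      have "h n \<xi> = (\<Sum>j. indicator (idx n ` (\<xi> \<inter> A)) j)"
        unfolding h_def using \<xi> by (intro suminf_cong) (auto simp: cell_def split: split_indicator)
      also have "\<dots> = emeasure (count_space UNIV) (idx n ` (\<xi> \<inter> A))"
        by (subst nn_integral_count_space_nat[symmetric]) (simp add: nn_integral_indicator)
      also have "\<dots> = of_nat (card (idx n ` (\<xi> \<inter> A)))"
        using finite_point_count(1)[OF \<xi> A(2)] by simp
      finally show ?thesis .
    qed
    have "point_count \<xi> A = (SUP n. h n \<xi>)" if "\<xi> \<in> space V" for \<xi>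
    proof -
      have \<xi>: "\<xi> \<in> configurations" using that by (simp add: spV)
      note fin = finite_point_count[OF \<xi> A(2)]
      obtain \<delta> where \<delta>: "\<delta> > 0" "\<And>x y. x \<in> \<xi> \<inter> A \<Longrightarrow> y \<in> \<xi> \<inter> A \<Longrightarrow> x \<noteq> y \<Longrightarrow> \<delta> \<le> dist x y"
        using finite_separated[OF fin(1)] by metis
      obtain n where n: "1 / Suc n < \<delta> / 2"
        using nat_approx_posE[of "\<delta> / 2"] \<delta>(1) by auto
      have "inj_on (idx n) (\<xi> \<inter> A)"
      proof (rule inj_onI, rule ccontr)
        fix x y assume xy: "x \<in> \<xi> \<inter> A" "y \<in> \<xi> \<inter> A" "idx n x = idx n y" "x \<noteq> y"
        have "dist x y \<le> dist x (d (idx n x)) + dist y (d (idx n x))"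
          by (rule dist_triangle2)
        also have "\<dots> < 2 * (1 / Suc n)"
          using idx[of x n] idx[of y n] xy(3) by simp
        finally show False using n \<delta>(2)[OF xy(1,2,4)] by simp
      qed
      then have "point_count \<xi> A = h n \<xi>"
        by (simp add: h_eq[OF \<xi>] fin(2) card_image)
      moreover have "h m \<xi> \<le> point_count \<xi> A" for m
        unfolding h_eq[OF \<xi>] fin(2) using card_image_le[OF fin(1)] by simp
      ultimately show ?thesis by (intro antisym SUP_least) (auto intro: SUP_upper2)
    qed
    moreover have "(\<lambda>\<xi>. SUP n. h n \<xi>) \<in> borel_measurable V"
      by (intro borel_measurable_SUP h_meas) auto
    ultimately show ?thesis by (simp cong: measurable_cong)
  qed
  have "{\<xi>\<in>configurations. point_count \<xi> A \<in> B} \<in> sets V"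
    if "A \<in> sets borel" "bounded A" "B \<in> sets borel" for A :: "'a set" and B
    using measurable_sets[OF pc[OF that(1,2)] that(3)]
    by (rule back_subst[of "\<lambda>x. x \<in> sets V"]) (auto simp: spV)
  then have "sigma_sets (space V) {{\<xi>\<in>configurations. point_count \<xi> A \<in> B} | A B.
      A \<in> sets borel \<and> bounded A \<and> B \<in> sets borel} \<subseteq> sets V"
    by (intro sets.sigma_sets_subset) auto
  then show "sets configuration_algebra \<subseteq> sigma_sets configurations (void_events :: 'a set set set)"
    unfolding configuration_algebra_def seV spV by (subst sets_measure_of) auto
  have "{\<xi>\<in>configurations. \<xi> \<inter> B = {}} \<in> sets configuration_algebra"
    if B: "B \<in> sets borel" "bounded B" for B :: "'a set"
  proof -
    have "(\<lambda>\<xi>. point_count \<xi> B) -` {0} \<inter> space configuration_algebra \<in> sets configuration_algebra"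
      by (rule measurable_sets[OF measurable_point_count[OF B]]) simp
    also have "(\<lambda>\<xi>. point_count \<xi> B) -` {0} \<inter> space configuration_algebra
        = {\<xi>\<in>configurations. \<xi> \<inter> B = {}}"
      using finite_point_count[OF _ B(2)] by auto
    finally show ?thesis .
  qed
  then show "sigma_sets configurations void_events \<subseteq> sets (configuration_algebra :: 'a set measure)"
    using sets.sigma_sets_subset[of void_events "configuration_algebra :: 'a set measure"]
    by (auto simp: void_events_def)
qed

lemma Int_stable_void_events: "Int_stable void_events"
  unfolding Int_stable_def void_events_def
proof safe
  fix B B' :: "'a set"
  assume "B \<in> sets borel" "bounded B" "B' \<in> sets borel" "bounded B'"
  then show "\<exists>B''. {\<xi> \<in> configurations. \<xi> \<inter> B = {}} \<inter> {\<xi> \<in> configurations. \<xi> \<inter> B' = {}}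
      = {\<xi> \<in> configurations. \<xi> \<inter> B'' = {}} \<and> B'' \<in> sets borel \<and> bounded B''"
    by (intro exI[of _ "B \<union> B'"]) auto
qed

section \<open>Counting injective tuples\<close>

definition inj_tuples :: "nat \<Rightarrow> (nat \<Rightarrow> 'a set) \<Rightarrow> (nat \<Rightarrow> 'a) set" where
  "inj_tuples n W = {x \<in> PiE {1..n} W. inj_on x {1..n}}"

lemma inj_tuples_0: "inj_tuples 0 W = {\<lambda>_. undefined}"
  by (auto simp: inj_tuples_def)

lemma finite_inj_tuples:
  assumes "\<And>i. i \<in> {1..n} \<Longrightarrow> finite (W i)"
  shows "finite (inj_tuples n W)"
  by (rule finite_subset[of _ "PiE {1..n} W"]) (use assms in \<open>auto simp: inj_tuples_def intro!: finite_PiE\<close>)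

lemma card_inj_tuples_le:
  assumes "\<And>i. i \<in> {1..n} \<Longrightarrow> finite (W i)"
  shows "card (inj_tuples n W) \<le> (\<Prod>i\<in>{1..n}. card (W i))"
proof -
  have "card (inj_tuples n W) \<le> card (PiE {1..n} W)"
    using assms by (intro card_mono finite_PiE) (auto simp: inj_tuples_def)
  then show ?thesis by (simp add: card_PiE)
qed

text \<open>The last entry of an injective tuple has to avoid the earlier entries, and exactly those with index
  in \<open>J\<close> lie in the last set. The difference is taken in the reals: if it is negative, there are no
  injective tuples of length \<open>n\<close> in the first place, and both sides vanish.\<close>

lemma card_inj_tuples_Suc:
  fixes W :: "nat \<Rightarrow> 'a set"
  assumes fin: "\<And>i. i \<in> {1..Suc n} \<Longrightarrow> finite (W i)"
    and J: "J \<subseteq> {1..n}"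
    and sub: "\<And>j. j \<in> J \<Longrightarrow> W j \<subseteq> W (Suc n)"
    and disj: "\<And>j. j \<in> {1..n} - J \<Longrightarrow> W j \<inter> W (Suc n) = {}"
  shows "real (card (inj_tuples (Suc n) W))
    = real (card (inj_tuples n W)) * (real (card (W (Suc n))) - real (card J))"
proof -
  let ?S = "SIGMA x:inj_tuples n W. W (Suc n) - x ` {1..n}"
  have ins: "{1..Suc n} = insert (Suc n) {1..n}" by auto
  have "inj_tuples (Suc n) W = (\<lambda>(x, y). x(Suc n := y)) ` ?S" (is "?L = ?R")
  proof (intro antisym subsetI)
    fix z assume "z \<in> ?R"
    then obtain x y where z: "z = x(Suc n := y)" and x: "x \<in> PiE {1..n} W" "inj_on x {1..n}"
      and y: "y \<in> W (Suc n)" "y \<notin> x ` {1..n}" by (auto simp: inj_tuples_def)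
    have "z \<in> PiE {1..Suc n} W" unfolding z ins using x y by (intro PiE_fun_upd) auto
    moreover have "inj_on z {1..Suc n}"
    proof -
      have e: "z i = x i" if "i \<in> {1..n}" for i using that by (simp add: z)
      have "inj_on z {1..n} = inj_on x {1..n}" by (rule inj_on_cong) (rule e)
      then have "inj_on z {1..n}" using x(2) by simp
      moreover have "z ` {1..n} = x ` {1..n}" using e by (rule image_cong[OF refl])
      moreover have "z (Suc n) = y" by (simp add: z)
      moreover have "{1..n} - {Suc n} = {1..n}" by auto
      ultimately show ?thesis unfolding ins inj_on_insert using y(2) by presburger
    qed
    ultimately show "z \<in> ?L" by (simp add: inj_tuples_def)
  next
    fix z assume "z \<in> ?L"
    then have z: "z \<in> PiE {1..Suc n} W" "inj_on z {1..Suc n}" by (auto simp: inj_tuples_def)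
    define x where "x = z(Suc n := undefined)"
    have "x \<in> PiE {1..n} W" unfolding x_def using z(1)[unfolded ins] by (intro fun_upd_in_PiE) auto
    moreover have "inj_on x {1..n}" using z(2) by (auto simp: x_def inj_on_def)
    moreover have "z (Suc n) \<in> W (Suc n)" using z(1) by auto
    moreover have "z (Suc n) \<notin> x ` {1..n}"
    proof
      assume "z (Suc n) \<in> x ` {1..n}"
      then obtain i where i: "i \<in> {1..n}" "z (Suc n) = z i" by (auto simp: x_def)
      from inj_onD[OF z(2) i(2)] i(1) show False by simp
    qed
    moreover have "z = x(Suc n := z (Suc n))" by (auto simp: x_def)
    ultimately show "z \<in> ?R" by (auto simp: inj_tuples_def intro!: image_eqI[of _ _ "(x, z (Suc n))"])
  qed
  moreover have "inj_on (\<lambda>(x, y). x(Suc n := y)) ?S"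
  proof (rule inj_onI, clarify)
    fix x y x' y'
    assume x: "x \<in> inj_tuples n W" "x' \<in> inj_tuples n W" and eq: "x(Suc n := y) = x'(Suc n := y')"
    have "x (Suc n) = undefined" "x' (Suc n) = undefined" using x by (auto simp: inj_tuples_def PiE_def extensional_def)
    then show "x = x' \<and> y = y'" using eq by (metis fun_upd_eqD fun_upd_triv fun_upd_upd)
  qed
  ultimately have "card (inj_tuples (Suc n) W) = card ?S" by (simp add: card_image)
  also have "\<dots> = (\<Sum>x\<in>inj_tuples n W. card (W (Suc n) - x ` {1..n}))"
    using fin by (intro card_SigmaI finite_inj_tuples) auto
  also have "real \<dots> = (\<Sum>x\<in>inj_tuples n W. real (card (W (Suc n))) - real (card J))"
    unfolding of_nat_sum
  proof (rule sum.cong[OF refl])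
    fix x assume "x \<in> inj_tuples n W"
    then have x: "\<And>i. i \<in> {1..n} \<Longrightarrow> x i \<in> W i" "inj_on x {1..n}" by (auto simp: inj_tuples_def)
    have eq: "W (Suc n) - x ` {1..n} = W (Suc n) - x ` J"
    proof -
      have "x i \<in> x ` J" if "i \<in> {1..n}" "x i \<in> W (Suc n)" for i
        using disj[of i] x(1)[OF that(1)] that by (cases "i \<in> J") auto
      then show ?thesis using J by auto
    qed
    have xJ: "x ` J \<subseteq> W (Suc n)" using x(1) J sub by blast
    have finW: "finite (W (Suc n))" using fin by simp
    have cJ: "card (x ` J) = card J"
      using x(2) J by (intro card_image) (rule inj_on_subset)
    have "card (W (Suc n) - x ` J) = card (W (Suc n)) - card J"
      using card_Diff_subset[OF finite_subset[OF xJ finW] xJ] cJ by simp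
    moreover have "card J \<le> card (W (Suc n))"
      using card_mono[OF finW xJ] cJ by simp
    ultimately show "real (card (W (Suc n) - x ` {1..n})) = real (card (W (Suc n))) - real (card J)"
      unfolding eq by simp
  qed
  finally show ?thesis by simp
qed

definition falling :: "nat \<Rightarrow> nat \<Rightarrow> nat" where
  "falling z n = (\<Prod>i<n. z - i)"

lemma falling_eq_choose: "falling z n = fact n * (z choose n)"
proof (induction n)
  case (Suc n)
  have "Suc n * (z choose Suc n) = (z - n) * (z choose n)"
    by (metis binomial_absorb_comp binomial_absorption)
  then have "fact n * (Suc n * (z choose Suc n)) = falling z n * (z - n)"
    using Suc by simp
  also have "\<dots> = falling z (Suc n)" by (simp add: falling_def)
  finally show ?case by (simp add: algebra_simps)
qed (simp add: falling_def)

text \<open>Since the \<open>V c\<close> are disjoint, an injective tuple in their union has exactly one colouring. This is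
  the multinomial Vandermonde identity for falling factorials.\<close>

lemma sum_card_coloured_inj_tuples:
  fixes V :: "'c \<Rightarrow> 'a set"
  assumes C: "finite C" and fin: "\<And>c. c \<in> C \<Longrightarrow> finite (V c)" and disj: "disjoint_family_on V C"
  shows "(\<Sum>c \<in> PiE {1..n} (\<lambda>_. C). card (inj_tuples n (\<lambda>i. V (c i))))
    = falling (\<Sum>c\<in>C. card (V c)) n"
proof -
  have "(\<Sum>c \<in> PiE {1..n} (\<lambda>_. C). card (inj_tuples n (\<lambda>i. V (c i))))
      = card (\<Union>c \<in> PiE {1..n} (\<lambda>_. C). inj_tuples n (\<lambda>i. V (c i)))"
  proof (rule card_UN_disjoint[symmetric])
    show "finite (PiE {1..n} (\<lambda>_. C))" using C by (intro finite_PiE) auto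
    show "\<forall>c\<in>PiE {1..n} (\<lambda>_. C). finite (inj_tuples n (\<lambda>i. V (c i)))"
      using fin by (auto intro!: finite_inj_tuples dest: PiE_mem)
    show "\<forall>c\<in>PiE {1..n} (\<lambda>_. C). \<forall>c'\<in>PiE {1..n} (\<lambda>_. C). c \<noteq> c' \<longrightarrow>
        inj_tuples n (\<lambda>i. V (c i)) \<inter> inj_tuples n (\<lambda>i. V (c' i)) = {}"
    proof (safe, rule ccontr)
      fix c c' x
      assume cc: "c \<in> PiE {1..n} (\<lambda>_. C)" "c' \<in> PiE {1..n} (\<lambda>_. C)" "c \<noteq> c'"
      then obtain i where i: "i \<in> {1..n}" "c i \<noteq> c' i" by (meson PiE_ext)
      assume "x \<in> inj_tuples n (\<lambda>i. V (c i))" "x \<in> inj_tuples n (\<lambda>i. V (c' i))"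
      then have "x i \<in> V (c i) \<inter> V (c' i)" using i by (auto simp: inj_tuples_def)
      then show False using disj i cc unfolding disjoint_family_on_def by (metis PiE_mem empty_iff)
    qed
  qed
  also have "(\<Union>c \<in> PiE {1..n} (\<lambda>_. C). inj_tuples n (\<lambda>i. V (c i)))
      = {x \<in> {1..n} \<rightarrow>\<^sub>E (\<Union>c\<in>C. V c). inj_on x {1..n}}" (is "?L = ?R")
  proof (intro antisym subsetI)
    fix x assume "x \<in> ?R"
    then have x: "x \<in> {1..n} \<rightarrow>\<^sub>E (\<Union>c\<in>C. V c)" "inj_on x {1..n}" by auto
    then have "\<forall>i\<in>{1..n}. \<exists>c\<in>C. x i \<in> V c" by (auto simp: PiE_iff)
    then obtain c where c: "\<forall>i\<in>{1..n}. c i \<in> C \<and> x i \<in> V (c i)" by metis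
    then have "x \<in> inj_tuples n (\<lambda>i. V (restrict c {1..n} i))" using x by (auto simp: inj_tuples_def PiE_iff)
    moreover have "restrict c {1..n} \<in> PiE {1..n} (\<lambda>_. C)" using c by auto
    ultimately show "x \<in> ?L" by blast
  next
    fix x assume "x \<in> ?L"
    then obtain c where c: "c \<in> PiE {1..n} (\<lambda>_. C)" "x \<in> PiE {1..n} (\<lambda>i. V (c i))" "inj_on x {1..n}"
      by (auto simp: inj_tuples_def)
    have "x \<in> {1..n} \<rightarrow>\<^sub>E (\<Union>c\<in>C. V c)"
      by (rule subsetD[OF PiE_mono c(2)]) (use PiE_mem[OF c(1)] in blast)
    then show "x \<in> ?R" using c(3) by simp
  qed
  also have "card \<dots> = prod ((-) (card (\<Union>c\<in>C. V c))) {0..<n}"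
    using C fin by (subst card_inj_on_subset_funcset) auto
  also have "card (\<Union>c\<in>C. V c) = (\<Sum>c\<in>C. card (V c))"
    using C fin disj by (intro card_UN_disjoint) (auto simp: disjoint_family_on_def)
  finally show ?thesis by (simp add: falling_def atLeast0LessThan)
qed

text \<open>This is \<open>(1 - 1)\<^sup>z\<close>, expanded. It expresses the probability that a counting variable vanishes by its
  factorial moments.\<close>

lemma alternating_falling_sums:
  "(\<lambda>n. (-1) ^ n / fact n * real (falling z n)) sums (if z = 0 then 1 else 0)"
proof -
  have "(\<lambda>n. (-1) ^ n / fact n * real (falling z n)) = (\<lambda>n. (-1) ^ n * real (z choose n))"
    by (simp add: falling_eq_choose)
  moreover have "(\<lambda>n. (-1) ^ n * real (z choose n)) sums (\<Sum>n\<le>z. (-1) ^ n * real (z choose n))"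
    by (rule sums_finite) (auto simp: binomial_eq_0)
  moreover have "(\<Sum>n\<le>z. (-1) ^ n * real (z choose n)) = (if z = 0 then 1 else 0)"
    using choose_alternating_sum[of z, where 'a = real] by simp
  ultimately show ?thesis by simp
qed

text \<open>If \<open>z \<ge> 2 p\<close> then each factor of the falling factorial is at least \<open>z / 2\<close>.\<close>

lemma power_le_falling:
  "real z ^ p \<le> 2 ^ p * real (falling z p) + (2 * real p) ^ p"
proof (cases "2 * p \<le> z")
  case True
  have "real z ^ p = (\<Prod>i<p. real z)" by simp
  also have "\<dots> \<le> (\<Prod>i<p. 2 * real (z - i))"
    using True by (intro prod_mono) (auto simp: of_nat_diff)
  also have "\<dots> = 2 ^ p * real (falling z p)" by (simp add: falling_def prod.distrib)
  finally show ?thesis by (smt (verit) of_nat_0_le_iff zero_le_power)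
next
  case False
  then have "real z ^ p \<le> (2 * real p) ^ p" by (intro power_mono) auto
  then show ?thesis by (smt (verit) mult_nonneg_nonneg of_nat_0_le_iff zero_le_power)
qed

section \<open>Poisson moments\<close>

lemma nn_integral_falling_poisson:
  assumes "r > 0"
  shows "(\<integral>\<^sup>+n. ennreal (real (falling n p)) \<partial>measure_pmf (poisson_pmf r)) = ennreal (r ^ p)"
proof -
  let ?f = "\<lambda>n. r ^ n / fact n * exp (- r) * real (falling n p)"
  have "?f (n + p) = r ^ p * exp (- r) * (r ^ n / fact n)" for n
  proof -
    have "real (falling (n + p) p) = fact (n + p) / fact n"
      using binomial_fact[of p "n + p", where 'a = real] by (simp add: falling_eq_choose)
    then show ?thesis by (simp add: power_add field_simps)
  qed
  moreover have "(\<lambda>n. r ^ p * exp (- r) * (r ^ n / fact n)) sums (r ^ p * exp (- r) * exp r)"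
    using sums_mult[OF exp_converges[of r], of "r ^ p * exp (- r)"]
    by (simp add: scaleR_conv_of_real divide_inverse mult.commute)
  ultimately have "(\<lambda>n. ?f (n + p)) sums (r ^ p * exp (- r) * exp r)"
    by simp
  moreover have "(\<Sum>n<p. ?f n) = 0"
    by (rule sum.neutral) (simp add: falling_eq_choose binomial_eq_0)
  ultimately have s: "?f sums (r ^ p)"
    using sums_iff_shift'[of ?f p "r ^ p"] by (simp add: mult.assoc flip: exp_add)
  have "(\<integral>\<^sup>+n. ennreal (real (falling n p)) \<partial>measure_pmf (poisson_pmf r))
      = (\<integral>\<^sup>+n. ennreal (?f n) \<partial>count_space UNIV)"
    unfolding nn_integral_measure_pmf using assms
    by (intro nn_integral_cong) (simp flip: ennreal_mult')
  also have "\<dots> = (\<Sum>n. ennreal (?f n))" by (rule nn_integral_count_space_nat)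
  also have "\<dots> = ennreal (r ^ p)" using assms s by (intro suminf_ennreal_eq) auto
  finally show ?thesis .
qed

section \<open>Families of dissociated Poisson processes\<close>

text \<open>The colours of \<open>C\<close> label the processes. An arbitrary finite set of colours is allowed because
  joint void probabilities have to be compared with those of subfamilies, single processes in
  particular.\<close>

locale dissociated_poisson_processes = prob_space P
  for P :: "'w measure" +
  fixes \<mu> :: "'a::polish_space measure" and T :: "'a \<Rightarrow> 'a" and S :: "'w \<Rightarrow> 'w"
    and N :: "nat \<Rightarrow> 'w \<Rightarrow> 'a set" and \<alpha> :: "nat \<Rightarrow> real" and C :: "nat set"
  assumes sets_mu [measurable_cong]: "sets \<mu> = sets borel"
    and boundedly_finite_mu: "boundedly_finite \<mu>"
    and infinite_mu: "emeasure \<mu> UNIV = \<infinity>"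
    and mpt_T: "invertible_mpt \<mu> T"
    and P2: "property_P2 \<mu> T"
    and mpt_S: "invertible_mpt P S"
    and finite_C: "finite C"
    and pos: "\<And>c. c \<in> C \<Longrightarrow> 0 < \<alpha> c"
    and process: "\<And>c. c \<in> C \<Longrightarrow> T_point_process \<mu> T P S (N c)"
    and poisson: "\<And>c. c \<in> C \<Longrightarrow> poisson_process \<mu> (\<alpha> c) P (N c)"
    and dissoc: "\<And>c d. c \<in> C \<Longrightarrow> d \<in> C \<Longrightarrow> c \<noteq> d \<Longrightarrow> dissociated P S (N c) (N d)"
begin

lemma space_mu: "space \<mu> = UNIV"
  using sets_eq_imp_space_eq[OF sets_mu] by simp

lemma measurable_mu_eq: "measurable \<mu> \<mu> = measurable borel borel"
  by (rule measurable_cong_sets) (auto simp: sets_mu)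

lemma T_measurable [measurable]: "T \<in> measurable borel borel"
  using mpt_T by (simp add: invertible_mpt_def preserves_def measurable_mu_eq)

lemma inv_T_measurable [measurable]: "inv T \<in> measurable borel borel"
  using mpt_T by (simp add: invertible_mpt_def measurable_mu_eq space_mu)

lemma bij_T: "bij T"
  using mpt_T by (simp add: invertible_mpt_def space_mu)

lemma T_power_measurable [measurable]: "T ^^ k \<in> measurable borel borel"
  by (induction k) (simp_all add: measurable_comp[of _ borel borel])

lemma inv_T_power_measurable [measurable]: "inv T ^^ k \<in> measurable borel borel"
  by (induction k) (simp_all add: measurable_comp[of _ borel borel])

lemma vimage_T_power_borel: "A \<in> sets borel \<Longrightarrow> (T ^^ k) -` A \<in> sets borel"
  using measurable_sets[OF T_power_measurable] by simp

lemma emeasure_vimage_T: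
  assumes "A \<in> sets borel" shows "emeasure \<mu> (T -` A) = emeasure \<mu> A"
proof -
  have "T \<in> measurable \<mu> \<mu>" "distr \<mu> \<mu> T = \<mu>" using mpt_T by (auto simp: invertible_mpt_def preserves_def)
  then have "emeasure \<mu> A = emeasure \<mu> (T -` A \<inter> space \<mu>)"
    using emeasure_distr[of T \<mu> \<mu> A] assms by (simp add: sets_mu)
  then show ?thesis by (simp add: space_mu)
qed

lemma emeasure_vimage_T_power:
  assumes "A \<in> sets borel" shows "emeasure \<mu> ((T ^^ k) -` A) = emeasure \<mu> A"
proof (induction k)
  case (Suc k)
  have "(T ^^ Suc k) -` A = T -` ((T ^^ k) -` A)" by (auto simp: funpow_swap1)
  then show ?case using Suc emeasure_vimage_T[OF vimage_T_power_borel[OF assms, of k]] by (simp only:)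
qed simp

lemma emeasure_bounded_finite:
  "B \<in> sets borel \<Longrightarrow> bounded B \<Longrightarrow> emeasure \<mu> B < \<infinity>"
  using boundedly_finite_mu by (auto simp: boundedly_finite_def sets_mu)

lemma emeasure_bounded: "B \<in> sets borel \<Longrightarrow> bounded B \<Longrightarrow> emeasure \<mu> B = ennreal (measure \<mu> B)"
  using emeasure_bounded_finite[of B] by (intro emeasure_eq_ennreal_measure) auto

lemma S_measurable [measurable]: "S \<in> measurable P P"
  using mpt_S by (simp add: invertible_mpt_def preserves_def)

lemma distr_S: "distr P P S = P"
  using mpt_S by (simp add: invertible_mpt_def preserves_def)

lemma AE_S:
  assumes "AE \<omega> in P. Q \<omega>" shows "AE \<omega> in P. Q (S \<omega>)"
proof -
  have "AE \<omega> in distr P P S. Q \<omega>" using assms by (simp only: distr_S)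
  then show ?thesis by (rule AE_distrD[OF S_measurable])
qed

lemma nn_integral_S:
  assumes "f \<in> borel_measurable P"
  shows "(\<integral>\<^sup>+\<omega>. f (S \<omega>) \<partial>P) = (\<integral>\<^sup>+\<omega>. f \<omega> \<partial>P)"
  using nn_integral_distr[OF S_measurable, of f] assms by (simp add: distr_S)

lemma N_measurable: "c \<in> C \<Longrightarrow> N c \<in> measurable P configuration_algebra"
  using process by (auto simp: T_point_process_def)

lemma N_configuration: "c \<in> C \<Longrightarrow> \<omega> \<in> space P \<Longrightarrow> N c \<omega> \<in> configurations"
  using measurable_space[OF N_measurable] by auto

lemma finite_N: "c \<in> C \<Longrightarrow> \<omega> \<in> space P \<Longrightarrow> bounded B \<Longrightarrow> finite (N c \<omega> \<inter> B)"
  using finite_point_count(1)[OF N_configuration] .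

text \<open>The two configurations are counting measures on all Borel sets, so testing them on singletons
  compares them as sets.\<close>

lemma AE_N_S: 
  assumes "c \<in> C" shows "AE \<omega> in P. N c (S \<omega>) = T ` N c \<omega>"
proof -
  have "AE \<omega> in P. \<forall>A\<in>sets borel. point_count (N c (S \<omega>)) A = point_count (N c \<omega>) (T -` A)"
    using process[OF assms] by (auto simp: T_point_process_def)
  then show ?thesis
  proof eventually_elim
    case (elim \<omega>)
    have "T y \<in> N c (S \<omega>) \<longleftrightarrow> y \<in> N c \<omega>" for y
    proof -
      have "T -` {T y} = {y}" using bij_T by (auto simp: bij_def inj_eq)
      then have "point_count (N c (S \<omega>)) {T y} = point_count (N c \<omega>) {y}"
        using elim[rule_format, of "{T y}"] by simp
      then show ?thesis
        by (cases "T y \<in> N c (S \<omega>)"; cases "y \<in> N c \<omega>") (auto simp: point_count_def)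
    qed
    then show "N c (S \<omega>) = T ` N c \<omega>"
      using bij_T by (auto simp: image_iff bij_def) (metis surjD)
  qed
qed

lemma AE_N_S_power:
  assumes "c \<in> C" shows "AE \<omega> in P. \<forall>k. N c ((S ^^ k) \<omega>) = (T ^^ k) ` N c \<omega>"
  unfolding AE_all_countable
proof
  fix k show "AE \<omega> in P. N c ((S ^^ k) \<omega>) = (T ^^ k) ` N c \<omega>"
  proof (induction k)
    case (Suc k)
    show ?case using AE_S[OF Suc] AE_N_S[OF assms]
      by eventually_elim (simp add: funpow_swap1 image_comp[symmetric] image_image)
  qed simp
qed

definition cnt :: "nat \<Rightarrow> 'a set \<Rightarrow> 'w \<Rightarrow> nat" where
  "cnt c B \<omega> = card (N c \<omega> \<inter> B)"

lemma point_count_N: "c \<in> C \<Longrightarrow> \<omega> \<in> space P \<Longrightarrow> bounded B \<Longrightarrow> point_count (N c \<omega>) B = of_nat (cnt c B \<omega>)"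
  using finite_point_count(2)[OF N_configuration] by (simp add: cnt_def)

lemma cnt_measurable:
  assumes c: "c \<in> C" and B: "B \<in> sets borel" "bounded B"
  shows "cnt c B \<in> measurable P (count_space UNIV)"
proof -
  have m: "(\<lambda>\<omega>. point_count (N c \<omega>) B) \<in> borel_measurable P"
    by (rule measurable_compose[OF N_measurable[OF c] measurable_point_count[OF B]])
  have "cnt c B -` {n} \<inter> space P \<in> sets P" for n
  proof -
    have "(\<lambda>\<omega>. point_count (N c \<omega>) B) -` {of_nat n} \<inter> space P \<in> sets P"
      using m by (rule measurable_sets) simp
    also have "(\<lambda>\<omega>. point_count (N c \<omega>) B) -` {of_nat n} \<inter> space P = cnt c B -` {n} \<inter> space P"
      using point_count_N[OF c _ B(2)] by auto
    finally show ?thesis .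
  qed
  then show ?thesis by (subst measurable_count_space_eq2_countable) auto
qed

lemma AE_cnt_null:
  assumes "c \<in> C" "B \<in> sets borel" "bounded B" "emeasure \<mu> B = 0"
  shows "AE \<omega> in P. cnt c B \<omega> = 0"
proof -
  have "AE \<omega> in P. point_count (N c \<omega>) B = 0"
    using process assms by (auto simp: T_point_process_def)
  then show ?thesis by (rule AE_mp) (auto simp: point_count_N assms)
qed

text \<open>The Poisson law is given for extended nonnegative counts; \<open>g\<close> below reads a function of a natural
  number as a Borel function of such a count.\<close>

lemma nn_integral_cnt:
  assumes c: "c \<in> C" and B: "B \<in> sets borel" "bounded B" "0 < emeasure \<mu> B"
  shows "(\<integral>\<^sup>+\<omega>. f (cnt c B \<omega>) \<partial>P) = (\<integral>\<^sup>+n. f n \<partial>measure_pmf (poisson_pmf (\<alpha> c * measure \<mu> B)))"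
proof -
  let ?p = "measure_pmf (poisson_pmf (\<alpha> c * measure \<mu> B))"
  define g where "g x = f (nat \<lfloor>enn2real x\<rfloor>)" for x
  have g: "g \<in> borel_measurable borel"
  proof -
    have "(\<lambda>x. nat \<lfloor>enn2real x\<rfloor>) \<in> measurable borel (count_space UNIV)" by measurable
    then show ?thesis unfolding g_def by (rule measurable_compose) simp
  qed
  have gn: "g (of_nat n) = f n" for n
    unfolding g_def by (simp add: ennreal_of_nat_eq_real_of_nat)
  have "distr P borel (\<lambda>\<omega>. point_count (N c \<omega>) B) = distr ?p borel of_nat"
    using poisson[OF c, unfolded poisson_process_def, rule_format, of 1 "\<lambda>_. B"] B emeasure_bounded_finite[of B]
    by (auto simp: disjoint_family_on_def)
  then have "(\<integral>\<^sup>+x. g x \<partial>distr P borel (\<lambda>\<omega>. point_count (N c \<omega>) B)) = (\<integral>\<^sup>+x. g x \<partial>distr ?p borel of_nat)"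
    by simp
  also have "(\<integral>\<^sup>+x. g x \<partial>distr P borel (\<lambda>\<omega>. point_count (N c \<omega>) B)) = (\<integral>\<^sup>+\<omega>. g (point_count (N c \<omega>) B) \<partial>P)"
    by (intro nn_integral_distr measurable_compose[OF N_measurable[OF c] measurable_point_count] B)
       (simp add: g)
  also have "\<dots> = (\<integral>\<^sup>+\<omega>. f (cnt c B \<omega>) \<partial>P)"
    by (intro nn_integral_cong) (simp add: point_count_N c B gn)
  also have "(\<integral>\<^sup>+x. g x \<partial>distr ?p borel of_nat) = (\<integral>\<^sup>+n. f n \<partial>?p)"
    by (subst nn_integral_distr) (auto simp: g gn)
  finally show ?thesis .
qed

lemma rate_pos:
  assumes "c \<in> C" "B \<in> sets borel" "bounded B" "0 < emeasure \<mu> B"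
  shows "0 < \<alpha> c * measure \<mu> B"
  using assms pos emeasure_bounded[of B] by (intro mult_pos_pos) auto

lemma nn_integral_falling_cnt:
  assumes c: "c \<in> C" and B: "B \<in> sets borel" "bounded B" "0 < emeasure \<mu> B"
  shows "(\<integral>\<^sup>+\<omega>. ennreal (real (falling (cnt c B \<omega>) p)) \<partial>P) = ennreal ((\<alpha> c * measure \<mu> B) ^ p)"
  using nn_integral_cnt[OF assms, where f = "\<lambda>n. ennreal (real (falling n p))"] nn_integral_falling_poisson[OF rate_pos[OF assms]] by simp

text \<open>Markov's inequality: the mean count is \<open>\<alpha> c * \<mu>(B)\<close>.\<close>

lemma prob_cnt_pos_le:
  assumes c: "c \<in> C" and B: "B \<in> sets borel" "bounded B"
  shows "prob {\<omega>\<in>space P. cnt c B \<omega> \<noteq> 0} \<le> \<alpha> c * measure \<mu> B"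
proof (cases "emeasure \<mu> B = 0")
  case True
  have "prob {\<omega>\<in>space P. cnt c B \<omega> \<noteq> 0} = 0"
    using AE_cnt_null[OF c B True] cnt_measurable[OF c B] by (subst prob_eq_0) auto
  then show ?thesis using pos[OF c] by simp
next
  case False
  then have pB: "0 < emeasure \<mu> B" by (simp add: zero_less_iff_neq_zero)
  have E: "{\<omega>\<in>space P. cnt c B \<omega> \<noteq> 0} \<in> sets P" using cnt_measurable[OF c B] by measurable
  have "ennreal (prob {\<omega>\<in>space P. cnt c B \<omega> \<noteq> 0}) = (\<integral>\<^sup>+\<omega>. indicator {\<omega>\<in>space P. cnt c B \<omega> \<noteq> 0} \<omega> \<partial>P)"
    using E by (simp add: emeasure_eq_measure)
  also have "\<dots> \<le> (\<integral>\<^sup>+\<omega>. ennreal (real (falling (cnt c B \<omega>) 1)) \<partial>P)"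
    by (intro nn_integral_mono) (auto simp: falling_def split: split_indicator)
  also have "\<dots> = ennreal (\<alpha> c * measure \<mu> B)" using nn_integral_falling_cnt[OF c B pB, of 1] by simp
  finally show ?thesis using pos[OF c] by simp
qed

lemma prob_cnt_pair_le:
  assumes c: "c \<in> C" and A: "A \<in> sets borel" "bounded A" and B: "B \<in> sets borel" "bounded B"
    and disj: "A \<inter> B = {}"
  shows "prob {\<omega>\<in>space P. cnt c A \<omega> \<noteq> 0 \<and> cnt c B \<omega> \<noteq> 0} \<le> (\<alpha> c * measure \<mu> A) * (\<alpha> c * measure \<mu> B)"
proof (cases "emeasure \<mu> A = 0 \<or> emeasure \<mu> B = 0")
  case True
  have [measurable]: "cnt c A \<in> measurable P (count_space UNIV)" "cnt c B \<in> measurable P (count_space UNIV)"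
    using cnt_measurable c A B by auto
  have "AE \<omega> in P. cnt c A \<omega> = 0 \<or> cnt c B \<omega> = 0"
    using True AE_cnt_null[OF c A] AE_cnt_null[OF c B] by (auto elim: AE_mp)
  then have "prob {\<omega>\<in>space P. cnt c A \<omega> \<noteq> 0 \<and> cnt c B \<omega> \<noteq> 0} = 0"
    by (subst prob_eq_0) (auto elim: AE_mp)
  then show ?thesis using pos[OF c] by simp
next
  case False
  define W where "W i = (if i = (1::nat) then A else B)" for i
  have W: "W i \<in> sets borel" "bounded (W i)" for i using A B by (auto simp: W_def)
  have "\<forall>i\<in>{1..2}. W i \<in> sets borel \<and> 0 < emeasure \<mu> (W i) \<and> emeasure \<mu> (W i) < \<infinity>"
    using W False emeasure_bounded_finite[OF A] emeasure_bounded_finite[OF B]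
    by (auto simp: W_def zero_less_iff_neq_zero)
  moreover have "disjoint_family_on W {1..2}"
    using disj by (auto simp: disjoint_family_on_def W_def)
  moreover have "(1::nat) \<le> 2" by simp
  ultimately have "indep_vars (\<lambda>_. borel) (\<lambda>i \<omega>. point_count (N c \<omega>) (W i)) {1..2}"
    using poisson[OF c, unfolded poisson_process_def] by blast
  from indep_varsD_finite[OF this, of "\<lambda>_. - {0}"]
  have "prob (\<Inter>i\<in>{1..2}. (\<lambda>\<omega>. point_count (N c \<omega>) (W i)) -` (- {0}) \<inter> space P)
      = (\<Prod>i\<in>{1..2}. prob ((\<lambda>\<omega>. point_count (N c \<omega>) (W i)) -` (- {0}) \<inter> space P))" by simp
  moreover have q: "(\<lambda>\<omega>. point_count (N c \<omega>) (W i)) -` (- {0}) \<inter> space P = {\<omega>\<in>space P. cnt c (W i) \<omega> \<noteq> 0}" for i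
    using point_count_N[OF c _ W(2)] by auto
  moreover have "{1..2} = {1, 2::nat}" by auto
  ultimately have "prob (\<Inter>i\<in>{1, 2}. {\<omega>\<in>space P. cnt c (W i) \<omega> \<noteq> 0})
      = (\<Prod>i\<in>{1, 2}. prob {\<omega>\<in>space P. cnt c (W i) \<omega> \<noteq> 0})"
    by (simp only: q)
  then have "prob ({\<omega>\<in>space P. cnt c A \<omega> \<noteq> 0} \<inter> {\<omega>\<in>space P. cnt c B \<omega> \<noteq> 0})
      = prob {\<omega>\<in>space P. cnt c A \<omega> \<noteq> 0} * prob {\<omega>\<in>space P. cnt c B \<omega> \<noteq> 0}"
    by (simp add: W_def)
  also have "\<dots> \<le> (\<alpha> c * measure \<mu> A) * (\<alpha> c * measure \<mu> B)"
    using prob_cnt_pos_le[OF c A] prob_cnt_pos_le[OF c B] pos[OF c]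
    by (intro mult_mono) auto
  finally show ?thesis by (simp add: Int_def conj_ac cong: conj_cong) 
qed

text \<open>The processes are simple, so a singleton contains at most one point, whereas a Poisson variable with
  positive parameter has a positive second factorial moment. Hence \<open>\<mu>\<close> has no atoms.\<close>

lemma emeasure_singleton:
  assumes "C \<noteq> {}"
  shows "emeasure \<mu> {x} = 0"
proof (rule ccontr)
  assume n0: "emeasure \<mu> {x} \<noteq> 0"
  obtain c where c: "c \<in> C" using assms by auto
  have B: "{x} \<in> sets borel" "bounded {x}" "0 < emeasure \<mu> {x}" using n0 by (auto simp: zero_less_iff_neq_zero)
  have "falling (cnt c {x} \<omega>) 2 = 0" for \<omega>
  proof -
    have "cnt c {x} \<omega> \<le> card {x}" unfolding cnt_def by (intro card_mono) auto
    then show ?thesis by (simp add: falling_eq_choose)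
  qed
  then have "ennreal ((\<alpha> c * measure \<mu> {x}) ^ 2) = 0"
    using nn_integral_falling_cnt[OF c B, of 2] by simp
  then show False using rate_pos[OF c B] by auto
qed

end

section \<open>Counting coloured tuples of points\<close>

lemma bij_betw_emeasure_count_space:
  assumes "bij_betw f A B"
  shows "emeasure (count_space UNIV) A = emeasure (count_space UNIV) B"
  using bij_betw_finite[OF assms] bij_betw_same_card[OF assms]
  by (cases "finite A") auto

lemma UN_balls: "(\<Union>r::nat. ball x (real r)) = (UNIV :: 'a::metric_space set)"
  using reals_Archimedean2 by (fastforce simp: dist_commute)

context dissociated_poisson_processes
begin

text \<open>The element \<open>undefined\<close> serves as an arbitrary base point of the space.\<close>

definition cube :: "nat \<Rightarrow> nat \<Rightarrow> (nat \<Rightarrow> 'a) set" where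
  "cube n r = PiE {1..n} (\<lambda>_. ball undefined (real r))"

definition colour_tuples :: "nat \<Rightarrow> (nat \<Rightarrow> nat) \<Rightarrow> 'w \<Rightarrow> (nat \<Rightarrow> 'a) set" where
  "colour_tuples n c \<omega> = PiE {1..n} (\<lambda>i. N (c i) \<omega>)"

definition tuple_count :: "nat \<Rightarrow> (nat \<Rightarrow> nat) \<Rightarrow> (nat \<Rightarrow> 'a) set \<Rightarrow> 'w \<Rightarrow> ennreal" where
  "tuple_count n c E \<omega> = emeasure (count_space UNIV) (colour_tuples n c \<omega> \<inter> E)"

lemma space_power: "space (power_algebra n) = PiE {1..n} (\<lambda>_. UNIV :: 'b::topological_space set)"
  by (simp add: power_algebra_def space_PiM)

lemma PiE_in_sets_power:
  "(\<And>i. i \<in> {1..n} \<Longrightarrow> B i \<in> sets borel) \<Longrightarrow> PiE {1..n} B \<in> sets (power_algebra n)"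
  unfolding power_algebra_def by (rule sets_PiM_I_finite) auto

lemma sets_power: "sets (power_algebra n :: (nat \<Rightarrow> 'a) measure) = sigma_sets (PiE {1..n} (\<lambda>_. UNIV)) (prod_algebra {1..n} (\<lambda>_. borel))"
  unfolding power_algebra_def sets_PiM by simp

lemma prod_algebraE_PiE:
  fixes n :: nat
  assumes "E \<in> prod_algebra {1..n} (\<lambda>_. borel :: 'a measure)"
  obtains B where "E = PiE {1..n} B" "\<And>i. i \<in> {1..n} \<Longrightarrow> B i \<in> sets borel"
proof -
  have "E \<in> {PiE {1..n} B | B. B \<in> {1..n} \<rightarrow> sets borel}"
    using assms(1) by (subst (asm) prod_algebra_eq_finite) auto
  then show ?thesis using that by (auto simp: Pi_iff)
qed

lemma cube_sets: "cube n r \<in> sets (power_algebra n)"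
  unfolding cube_def by (intro PiE_in_sets_power) auto

lemma incseq_cube: "incseq (cube n)"
proof (rule incseq_SucI)
  fix r show "cube n r \<subseteq> cube n (Suc r)"
    unfolding cube_def by (intro PiE_mono subset_ball) simp
qed

lemma UN_cube: "(\<Union>r. cube n r) = space (power_algebra n)"
proof (intro antisym subsetI)
  fix x :: "nat \<Rightarrow> 'a" assume x: "x \<in> space (power_algebra n)"
  have "\<exists>r::nat. Max (insert 0 ((\<lambda>i. dist undefined (x i)) ` {1..n})) < real r"
    by (rule reals_Archimedean2)
  then obtain r :: nat where r: "Max (insert 0 ((\<lambda>i. dist undefined (x i)) ` {1..n})) < real r" ..
  have "dist undefined (x i) < real r" if "i \<in> {1..n}" for i
    using r that by (subst (asm) Max_less_iff) auto
  then have "x \<in> cube n r" using x by (auto simp: cube_def space_power PiE_iff)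
  then show "x \<in> (\<Union>r. cube n r)" by blast
qed (auto simp: cube_def space_power PiE_iff)

lemma colour_tuples_Int_PiE:
  "colour_tuples n c \<omega> \<inter> PiE {1..n} B = PiE {1..n} (\<lambda>i. N (c i) \<omega> \<inter> B i)"
  by (auto simp: colour_tuples_def PiE_iff)

lemma finite_colour_tuples_PiE:
  assumes "\<And>i. i \<in> {1..n} \<Longrightarrow> c i \<in> C" "\<omega> \<in> space P" "\<And>i. i \<in> {1..n} \<Longrightarrow> bounded (B i)"
  shows "finite (colour_tuples n c \<omega> \<inter> PiE {1..n} B)"
  unfolding colour_tuples_Int_PiE using assms by (intro finite_PiE finite_N) auto

lemma tuple_count_PiE:
  assumes "\<And>i. i \<in> {1..n} \<Longrightarrow> c i \<in> C" "\<omega> \<in> space P" "\<And>i. i \<in> {1..n} \<Longrightarrow> bounded (B i)"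
  shows "tuple_count n c (PiE {1..n} B) \<omega> = (\<Prod>i\<in>{1..n}. of_nat (cnt (c i) (B i) \<omega>))"
proof -
  have "tuple_count n c (PiE {1..n} B) \<omega> = of_nat (card (PiE {1..n} (\<lambda>i. N (c i) \<omega> \<inter> B i)))"
    using finite_colour_tuples_PiE[OF assms, unfolded colour_tuples_Int_PiE]
    unfolding tuple_count_def colour_tuples_Int_PiE by simp
  then show ?thesis by (simp add: card_PiE cnt_def)
qed

text \<open>Inside a cube all counts are finite, so complements are handled by subtraction and the claim spreads
  from rectangles, where the count is a product, to all measurable sets by Dynkin's lemma.\<close>

lemma tuple_count_bounded_measurable:
  assumes c: "\<And>i. i \<in> {1..n} \<Longrightarrow> c i \<in> C" and E: "E \<in> sets (power_algebra n)"
  shows "tuple_count n c (cube n r \<inter> E) \<in> borel_measurable P"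
proof -
  have fin: "finite (colour_tuples n c \<omega> \<inter> (cube n r \<inter> A))" if "\<omega> \<in> space P" for \<omega> A
    by (rule finite_subset[OF _ finite_colour_tuples_PiE[of n c \<omega> "\<lambda>_. ball undefined (real r)"]])
       (use c that in \<open>auto simp: cube_def\<close>)
  have rect: "tuple_count n c (cube n r \<inter> PiE {1..n} B) \<in> borel_measurable P"
    if B: "\<And>i. i \<in> {1..n} \<Longrightarrow> B i \<in> sets borel" for B
  proof -
    have eq: "cube n r \<inter> PiE {1..n} B = PiE {1..n} (\<lambda>i. ball undefined (real r) \<inter> B i)"
      by (auto simp: cube_def PiE_iff)
    have m: "cnt (c i) (ball undefined (real r) \<inter> B i) \<in> measurable P (count_space UNIV)" if "i \<in> {1..n}" for i
      using c B that by (intro cnt_measurable) (auto intro: bounded_subset)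
    have "(\<lambda>\<omega>. \<Prod>i\<in>{1..n}. of_nat (cnt (c i) (ball undefined (real r) \<inter> B i) \<omega>) :: ennreal) \<in> borel_measurable P"
      by (intro borel_measurable_prod_ennreal measurable_compose[OF m]) auto
    then show ?thesis
      unfolding eq
      by (subst measurable_cong[OF tuple_count_PiE]) (auto intro: c bounded_subset)
  qed
  have sub: "prod_algebra {1..n} (\<lambda>_. borel :: 'a measure) \<subseteq> Pow (PiE {1..n} (\<lambda>_. UNIV))"
    using prod_algebra_sets_into_space[of "{1..n}" "\<lambda>_. borel :: 'a measure"] by simp
  show ?thesis
    using Int_stable_prod_algebra sub E[unfolded sets_power]
  proof (induction rule: sigma_sets_induct_disjoint)
    case (basic A)
    then show ?case by (elim prod_algebraE_PiE) (use rect in blast)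
  next
    case empty
    have "tuple_count n c (cube n r \<inter> {}) = (\<lambda>_. 0)" by (auto simp: tuple_count_def)
    then show ?case by simp
  next
    case (compl A)
    have "tuple_count n c (cube n r) \<in> borel_measurable P"
      using rect[of "\<lambda>_. UNIV"] UN_cube[of n] space_power[of n] by (simp add: cube_def Int_absorb2 PiE_mono)
    moreover have "tuple_count n c (cube n r \<inter> (PiE {1..n} (\<lambda>_. UNIV) - A)) \<omega>
        = tuple_count n c (cube n r) \<omega> - tuple_count n c (cube n r \<inter> A) \<omega>" if "\<omega> \<in> space P" for \<omega>
    proof -
      have "colour_tuples n c \<omega> \<inter> (cube n r \<inter> (PiE {1..n} (\<lambda>_. UNIV) - A))
          = colour_tuples n c \<omega> \<inter> cube n r - colour_tuples n c \<omega> \<inter> (cube n r \<inter> A)"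
        by (auto simp: cube_def PiE_iff)
      then show ?thesis
        unfolding tuple_count_def using fin[OF that, of A]
        by (simp only:) (intro emeasure_Diff, auto)
    qed
    ultimately show ?case using compl by (simp cong: measurable_cong)
  next
    case (union A)
    have "tuple_count n c (cube n r \<inter> (\<Union>i. A i)) \<omega> = (\<Sum>i. tuple_count n c (cube n r \<inter> A i) \<omega>)" for \<omega>
    proof -
      have "(\<Sum>i. tuple_count n c (cube n r \<inter> A i) \<omega>)
          = emeasure (count_space UNIV) (\<Union>i. colour_tuples n c \<omega> \<inter> (cube n r \<inter> A i))"
        unfolding tuple_count_def using union(1)
        by (intro suminf_emeasure) (auto simp: disjoint_family_on_def)
      moreover have "colour_tuples n c \<omega> \<inter> (cube n r \<inter> (\<Union>i. A i))
          = (\<Union>i. colour_tuples n c \<omega> \<inter> (cube n r \<inter> A i))" by blast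
      ultimately show ?thesis by (simp only: tuple_count_def)
    qed
    then show ?case using union by (simp cong: measurable_cong)
  qed
qed

lemma tuple_count_measurable:
  assumes c: "\<And>i. i \<in> {1..n} \<Longrightarrow> c i \<in> C" and E: "E \<in> sets (power_algebra n)"
  shows "tuple_count n c E \<in> borel_measurable P"
proof -
  have "tuple_count n c E \<omega> = (SUP r. tuple_count n c (cube n r \<inter> E) \<omega>)" for \<omega>
  proof -
    have "E \<subseteq> (\<Union>r. cube n r)" using sets.sets_into_space[OF E] by (simp add: UN_cube)
    then have eq: "colour_tuples n c \<omega> \<inter> E = (\<Union>r. colour_tuples n c \<omega> \<inter> (cube n r \<inter> E))" by auto
    have "incseq (\<lambda>r. colour_tuples n c \<omega> \<inter> (cube n r \<inter> E))"
      using incseq_cube[of n] by (fastforce simp: incseq_def)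
    then show ?thesis unfolding tuple_count_def eq by (intro SUP_emeasure_incseq[symmetric]) auto
  qed
  then show ?thesis
    using tuple_count_bounded_measurable[OF c E] by (simp add: borel_measurable_SUP cong: measurable_cong)
qed

section \<open>The moment measure off the orbit diagonals\<close>

text \<open>Natural exponents suffice, because the condition is imposed on both orders of each pair of
  coordinates.\<close>

definition orbit_free :: "nat \<Rightarrow> (nat \<Rightarrow> 'a) set" where
  "orbit_free n = {x \<in> space (power_algebra n).
     \<forall>i\<in>{1..n}. \<forall>j\<in>{1..n}. i \<noteq> j \<longrightarrow> (\<forall>k. x i \<noteq> (T ^^ k) (x j))}"

lemma orbit_free_sets: "orbit_free n \<in> sets (power_algebra n)"
proof -
  have [measurable]: "(\<lambda>x. x i) \<in> borel_measurable (power_algebra n)" if "i \<in> {1..n}" for i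
    unfolding power_algebra_def using that by (rule measurable_component_singleton)
  have [measurable]: "(\<lambda>x. (T ^^ k) (x i)) \<in> borel_measurable (power_algebra n)" if "i \<in> {1..n}" for i k
    using that by (intro measurable_compose[OF _ T_power_measurable]) auto
  have "{x \<in> space (power_algebra n). x i = (T ^^ k) (x j)} \<in> sets (power_algebra n)"
    if "i \<in> {1..n}" "j \<in> {1..n}" for i j k
    using that by (intro measurable_equality_set) auto
  then have "space (power_algebra n) - (\<Union>i\<in>{1..n}. \<Union>j\<in>{1..n} - {i}. \<Union>k.
      {x \<in> space (power_algebra n). x i = (T ^^ k) (x j)}) \<in> sets (power_algebra n)"
    by (intro sets.Diff sets.finite_UN sets.countable_UN') auto
  then show ?thesis
    by (rule back_subst[of "\<lambda>E. E \<in> sets (power_algebra n)"]) (auto simp: orbit_free_def, metis atLeastAtMost_iff)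
qed

lemma power_map_measurable [measurable]: "power_map n T \<in> measurable (power_algebra n) (power_algebra n)"
  unfolding power_algebra_def power_map_def
  by (intro measurable_restrict measurable_compose[OF _ T_measurable] measurable_component_singleton)

text \<open>The expected number of orbit-free tuples of points whose \<open>i\<close>-th entry has colour \<open>c i\<close>. It is
  invariant under the product map because moving \<open>\<omega>\<close> by \<open>S\<close> moves all points by \<open>T\<close>.\<close>

definition moment_measure :: "nat \<Rightarrow> (nat \<Rightarrow> nat) \<Rightarrow> (nat \<Rightarrow> 'a) measure" where
  "moment_measure n c = measure_of (space (power_algebra n)) (sets (power_algebra n))
     (\<lambda>E. \<integral>\<^sup>+\<omega>. tuple_count n c (orbit_free n \<inter> E) \<omega> \<partial>P)"

lemma sets_moment_measure: "sets (moment_measure n c) = sets (power_algebra n)"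
  unfolding moment_measure_def by simp

lemma space_moment_measure: "space (moment_measure n c) = space (power_algebra n)"
  using sets_eq_imp_space_eq[OF sets_moment_measure] .

lemma emeasure_moment_measure:
  assumes c: "\<And>i. i \<in> {1..n} \<Longrightarrow> c i \<in> C" and E: "E \<in> sets (power_algebra n)"
  shows "emeasure (moment_measure n c) E = (\<integral>\<^sup>+\<omega>. tuple_count n c (orbit_free n \<inter> E) \<omega> \<partial>P)"
proof (rule emeasure_measure_of[OF moment_measure_def])
  show "countably_additive (sets (moment_measure n c)) (\<lambda>E. \<integral>\<^sup>+\<omega>. tuple_count n c (orbit_free n \<inter> E) \<omega> \<partial>P)"
    unfolding sets_moment_measure
  proof (rule countably_additiveI)
    fix A :: "nat \<Rightarrow> (nat \<Rightarrow> 'a) set"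
    assume A: "range A \<subseteq> sets (power_algebra n)" "disjoint_family A" "(\<Union>i. A i) \<in> sets (power_algebra n)"
    have "tuple_count n c (orbit_free n \<inter> (\<Union>i. A i)) \<omega> = (\<Sum>i. tuple_count n c (orbit_free n \<inter> A i) \<omega>)" for \<omega>
    proof -
      have "(\<Sum>i. tuple_count n c (orbit_free n \<inter> A i) \<omega>)
          = emeasure (count_space UNIV) (\<Union>i. colour_tuples n c \<omega> \<inter> (orbit_free n \<inter> A i))"
        unfolding tuple_count_def using A(2)
        by (intro suminf_emeasure) (auto simp: disjoint_family_on_def)
      moreover have "colour_tuples n c \<omega> \<inter> (orbit_free n \<inter> (\<Union>i. A i))
          = (\<Union>i. colour_tuples n c \<omega> \<inter> (orbit_free n \<inter> A i))" by blast
      ultimately show ?thesis by (simp only: tuple_count_def)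
    qed
    moreover have "tuple_count n c (orbit_free n \<inter> A i) \<in> borel_measurable P" for i
      using A(1) orbit_free_sets by (intro tuple_count_measurable c) auto
    ultimately show "(\<Sum>i. \<integral>\<^sup>+\<omega>. tuple_count n c (orbit_free n \<inter> A i) \<omega> \<partial>P)
        = (\<integral>\<^sup>+\<omega>. tuple_count n c (orbit_free n \<inter> (\<Union>i. A i)) \<omega> \<partial>P)"
      by (simp add: nn_integral_suminf)
  qed
  show "positive (sets (moment_measure n c)) (\<lambda>E. \<integral>\<^sup>+\<omega>. tuple_count n c (orbit_free n \<inter> E) \<omega> \<partial>P)"
    by (simp add: positive_def tuple_count_def)
qed (use E in \<open>auto simp: sets_moment_measure dest: sets.sets_into_space\<close>)

lemma T_power_T: "T ((T ^^ k) x) = (T ^^ k) (T x)"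
  by (simp add: funpow_swap1)

lemma power_map_orbit_free_iff:
  assumes "x \<in> space (power_algebra n)"
  shows "power_map n T x \<in> orbit_free n \<longleftrightarrow> x \<in> orbit_free n"
proof -
  have "T y \<noteq> (T ^^ k) (T z) \<longleftrightarrow> y \<noteq> (T ^^ k) z" for y z k
    using bij_T by (simp add: T_power_T[symmetric] bij_def inj_eq)
  then show ?thesis using assms by (auto simp: orbit_free_def power_map_def space_power)
qed

lemma tuple_count_power_map:
  assumes E: "E \<in> sets (power_algebra n)" and eq: "\<And>i. i \<in> {1..n} \<Longrightarrow> N (c i) \<omega>' = T ` N (c i) \<omega>"
  shows "tuple_count n c (orbit_free n \<inter> (power_map n T -` E \<inter> space (power_algebra n))) \<omega>
    = tuple_count n c (orbit_free n \<inter> E) \<omega>'"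
  unfolding tuple_count_def
proof (rule bij_betw_emeasure_count_space)
  let ?A = "colour_tuples n c \<omega> \<inter> (orbit_free n \<inter> (power_map n T -` E \<inter> space (power_algebra n)))"
  let ?B = "colour_tuples n c \<omega>' \<inter> (orbit_free n \<inter> E)"
  have T: "T (inv T y) = y" "inv T (T y) = y" for y
    using bij_T by (simp_all add: bij_def surj_f_inv_f)
  show "bij_betw (power_map n T) ?A ?B"
  proof (rule bij_betw_byWitness[where f' = "power_map n (inv T)"])
    show "\<forall>x\<in>?A. power_map n (inv T) (power_map n T x) = x"
      by (auto simp: power_map_def T space_power PiE_iff extensional_def restrict_def fun_eq_iff)
    have rev: "power_map n T (power_map n (inv T) y) = y" if "y \<in> orbit_free n" for y
      using that by (auto simp: power_map_def T space_power PiE_iff extensional_def restrict_def fun_eq_iff orbit_free_def)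
    then show "\<forall>y\<in>?B. power_map n T (power_map n (inv T) y) = y" by blast
    show "power_map n T ` ?A \<subseteq> ?B"
    proof (rule image_subsetI)
      fix x assume x: "x \<in> ?A"
      have "T (x i) \<in> N (c i) \<omega>'" if "i \<in> {1..n}" for i
        using x that eq[OF that] by (auto simp: colour_tuples_def dest: PiE_mem)
      then have "power_map n T x \<in> colour_tuples n c \<omega>'"
        by (auto simp: colour_tuples_def power_map_def)
      then show "power_map n T x \<in> ?B" using x power_map_orbit_free_iff by blast
    qed
    show "power_map n (inv T) ` ?B \<subseteq> ?A"
    proof (rule image_subsetI)
      fix y assume y: "y \<in> ?B"
      have sp: "power_map n (inv T) y \<in> space (power_algebra n)" by (auto simp: power_map_def space_power)
      have b: "power_map n T (power_map n (inv T) y) = y" using y rev by blast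
      have "power_map n (inv T) y \<in> orbit_free n"
        using power_map_orbit_free_iff[OF sp] b y by simp
      moreover have "power_map n (inv T) y \<in> colour_tuples n c \<omega>"
        using y eq by (fastforce simp: colour_tuples_def power_map_def T PiE_iff)
      ultimately show "power_map n (inv T) y \<in> ?A" using sp b y by simp
    qed
  qed
qed

lemma moment_measure_invariant:
  assumes c: "\<And>i. i \<in> {1..n} \<Longrightarrow> c i \<in> C"
  shows "preserves (moment_measure n c) (power_map n T)"
proof -
  let ?M = "moment_measure n c"
  have meas: "power_map n T \<in> measurable ?M ?M"
    using power_map_measurable measurable_cong_sets[OF sets_moment_measure sets_moment_measure] by blast
  have "distr ?M ?M (power_map n T) = ?M"
  proof (rule measure_eqI)
    fix E assume "E \<in> sets (distr ?M ?M (power_map n T))"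
    then have E: "E \<in> sets (power_algebra n)" by (simp add: sets_moment_measure)
    let ?E' = "power_map n T -` E \<inter> space (power_algebra n)"
    have E': "?E' \<in> sets (power_algebra n)" using power_map_measurable E by (rule measurable_sets)
    have "AE \<omega> in P. \<forall>i\<in>{1..n}. N (c i) (S \<omega>) = T ` N (c i) \<omega>"
      by (intro AE_finite_allI AE_N_S c) auto
    then have AE: "AE \<omega> in P. tuple_count n c (orbit_free n \<inter> ?E') \<omega> = tuple_count n c (orbit_free n \<inter> E) (S \<omega>)"
      by eventually_elim (rule tuple_count_power_map[OF E], auto)
    have "emeasure (distr ?M ?M (power_map n T)) E = emeasure ?M ?E'"
      using E by (simp add: emeasure_distr[OF meas] sets_moment_measure space_moment_measure)
    also have "\<dots> = (\<integral>\<^sup>+\<omega>. tuple_count n c (orbit_free n \<inter> ?E') \<omega> \<partial>P)"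
      by (rule emeasure_moment_measure[OF c E'])
    also have "\<dots> = (\<integral>\<^sup>+\<omega>. tuple_count n c (orbit_free n \<inter> E) (S \<omega>) \<partial>P)"
      using AE by (rule nn_integral_cong_AE)
    also have "\<dots> = (\<integral>\<^sup>+\<omega>. tuple_count n c (orbit_free n \<inter> E) \<omega> \<partial>P)"
      using E orbit_free_sets by (intro nn_integral_S tuple_count_measurable c) auto
    also have "\<dots> = emeasure ?M E" by (rule emeasure_moment_measure[OF c E, symmetric])
    finally show "emeasure (distr ?M ?M (power_map n T)) E = emeasure ?M E" .
  qed simp
  with meas show ?thesis by (simp add: preserves_def)
qed

end

section \<open>Moment measures are multiples of the product measure\<close>

lemma prod_le_sum_power:
  fixes x :: "'i \<Rightarrow> real"
  assumes "finite I" "I \<noteq> {}" "\<And>i. i \<in> I \<Longrightarrow> 0 \<le> x i"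
  shows "(\<Prod>i\<in>I. x i) \<le> (\<Sum>i\<in>I. x i ^ card I)"
proof -
  have "Max (x ` I) \<in> x ` I" using assms by (intro Max_in) auto
  then obtain m where m: "m \<in> I" "x m = Max (x ` I)" by auto
  have "(\<Prod>i\<in>I. x i) \<le> (\<Prod>i\<in>I. x m)"
    using assms by (intro prod_mono) (auto simp: m(2))
  also have "\<dots> = x m ^ card I" by simp
  also have "\<dots> \<le> (\<Sum>i\<in>I. x i ^ card I)"
    using assms m(1) by (intro member_le_sum) auto
  finally show ?thesis .
qed

lemma measurable_emeasure_measures_algebra:
  assumes "A \<in> sets M"
  shows "(\<lambda>\<nu>. emeasure \<nu> A) \<in> borel_measurable (measures_algebra M)"
proof (rule measurableI)
  fix B :: "ennreal set" assume B: "B \<in> sets borel"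
  have sub: "{{\<nu>. sets \<nu> = sets M \<and> emeasure \<nu> A \<in> B} | A B. A \<in> sets M \<and> B \<in> sets borel} \<subseteq> Pow {\<nu>. sets \<nu> = sets M}"
    by auto
  have "(\<lambda>\<nu>. emeasure \<nu> A) -` B \<inter> space (measures_algebra M) = {\<nu>. sets \<nu> = sets M \<and> emeasure \<nu> A \<in> B}"
    unfolding measures_algebra_def space_measure_of[OF sub] by auto
  also have "\<dots> \<in> sets (measures_algebra M)"
    unfolding measures_algebra_def sets_measure_of[OF sub] using assms B by (intro sigma_sets.Basic) auto
  finally show "(\<lambda>\<nu>. emeasure \<nu> A) -` B \<inter> space (measures_algebra M) \<in> sets (measures_algebra M)" .
qed simp

context dissociated_poisson_processes
begin

definition mass :: "nat \<Rightarrow> real" where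
  "mass r = measure \<mu> (ball undefined (real r))"

lemma emeasure_ball: "emeasure \<mu> (ball undefined (real r)) = ennreal (mass r)"
  unfolding mass_def by (rule emeasure_bounded) auto

lemma mass_at_top: "filterlim mass at_top sequentially"
  unfolding filterlim_at_top
proof
  fix Z :: real
  have "(\<lambda>r. emeasure \<mu> (ball undefined (real r))) \<longlonglongrightarrow> emeasure \<mu> (\<Union>r. ball undefined (real r))"
    by (intro Lim_emeasure_incseq) (auto simp: sets_mu incseq_def)
  then have "(\<lambda>r. ennreal (mass r)) \<longlonglongrightarrow> \<infinity>"
    by (simp add: emeasure_ball UN_balls infinite_mu)
  then have "eventually (\<lambda>r. ennreal Z < ennreal (mass r)) sequentially"
    by (rule order_tendstoD(1)) simp
  then show "eventually (\<lambda>r. Z \<le> mass r) sequentially"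
  proof eventually_elim
    case (elim r)
    show ?case
    proof (rule ccontr)
      assume "\<not> Z \<le> mass r"
      then have "ennreal (mass r) \<le> ennreal Z" by (intro ennreal_leI) simp
      then show False using elim by (simp add: not_le[symmetric])
    qed
  qed
qed

text \<open>The powers of \<open>\<mu>(B)\<close> are the correct order of growth for large sets, and they are all that the
  comparison of coefficients below needs; the lower order terms are absorbed using \<open>\<mu>(B) \<ge> 1\<close>.\<close>

lemma nn_integral_cnt_power_le:
  assumes c: "c \<in> C" and B: "B \<in> sets borel" "bounded B" "1 \<le> measure \<mu> B"
  shows "(\<integral>\<^sup>+\<omega>. ennreal (real (cnt c B \<omega>) ^ p) \<partial>P) \<le> ennreal (((2 * \<alpha> c) ^ p + (2 * real p) ^ p) * measure \<mu> B ^ p)"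
proof -
  have [measurable]: "cnt c B \<in> measurable P (count_space UNIV)" using c B by (intro cnt_measurable) auto
  have pB: "0 < emeasure \<mu> B" using B emeasure_bounded[of B] by simp
  have "(\<integral>\<^sup>+\<omega>. ennreal (real (cnt c B \<omega>) ^ p) \<partial>P)
      \<le> (\<integral>\<^sup>+\<omega>. ennreal (2 ^ p) * ennreal (real (falling (cnt c B \<omega>) p)) + ennreal ((2 * real p) ^ p) \<partial>P)"
  proof (intro nn_integral_mono)
    fix \<omega>
    have "ennreal (real (cnt c B \<omega>) ^ p) \<le> ennreal (2 ^ p * real (falling (cnt c B \<omega>) p) + (2 * real p) ^ p)"
      by (intro ennreal_leI power_le_falling)
    then show "ennreal (real (cnt c B \<omega>) ^ p)
        \<le> ennreal (2 ^ p) * ennreal (real (falling (cnt c B \<omega>) p)) + ennreal ((2 * real p) ^ p)"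
      by (simp only: ennreal_plus ennreal_mult' of_nat_0_le_iff zero_le_power zero_le_numeral mult_nonneg_nonneg)
  qed
  also have "\<dots> = ennreal (2 ^ p) * ennreal ((\<alpha> c * measure \<mu> B) ^ p) + ennreal ((2 * real p) ^ p)"
    using nn_integral_falling_cnt[OF c B(1,2) pB, of p]
    by (subst nn_integral_add) (auto simp: nn_integral_cmult emeasure_space_1)
  also have "\<dots> = ennreal ((2 * \<alpha> c) ^ p * measure \<mu> B ^ p + (2 * real p) ^ p)"
    using pos[OF c] by (simp add: power_mult_distrib mult.assoc flip: ennreal_mult' ennreal_plus)
  also have "\<dots> \<le> ennreal (((2 * \<alpha> c) ^ p + (2 * real p) ^ p) * measure \<mu> B ^ p)"
    using B(3) mult_left_mono[OF one_le_power[OF B(3), of p], of "(2 * real p) ^ p"]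
    by (intro ennreal_leI) (simp add: distrib_right)
  finally show ?thesis .
qed

definition moment_const :: "nat \<Rightarrow> (nat \<Rightarrow> nat) \<Rightarrow> nat \<Rightarrow> real" where
  "moment_const n c q = (\<Sum>i\<in>{1..n}. (2 * \<alpha> (c i)) ^ (q * n) + (2 * real (q * n)) ^ (q * n))"

lemma nn_integral_prod_cnt_le:
  assumes n: "n \<ge> 1" and c: "\<And>i. i \<in> {1..n} \<Longrightarrow> c i \<in> C" and B: "B \<in> sets borel" "bounded B" "1 \<le> measure \<mu> B"
  shows "(\<integral>\<^sup>+\<omega>. ennreal ((\<Prod>i\<in>{1..n}. real (cnt (c i) B \<omega>)) ^ q) \<partial>P)
    \<le> ennreal (moment_const n c q * measure \<mu> B ^ (q * n))"
proof -
  have m: "cnt (c i) B \<in> measurable P (count_space UNIV)" if "i \<in> {1..n}" for i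
    using c[OF that] B by (intro cnt_measurable) auto
  have "(\<integral>\<^sup>+\<omega>. ennreal ((\<Prod>i\<in>{1..n}. real (cnt (c i) B \<omega>)) ^ q) \<partial>P)
      \<le> (\<integral>\<^sup>+\<omega>. (\<Sum>i\<in>{1..n}. ennreal (real (cnt (c i) B \<omega>) ^ (q * n))) \<partial>P)"
  proof (intro nn_integral_mono)
    fix \<omega>
    have "(\<Prod>i\<in>{1..n}. real (cnt (c i) B \<omega>) ^ q) \<le> (\<Sum>i\<in>{1..n}. (real (cnt (c i) B \<omega>) ^ q) ^ card {1..n})"
      using n by (intro prod_le_sum_power) auto
    then have "ennreal ((\<Prod>i\<in>{1..n}. real (cnt (c i) B \<omega>)) ^ q) \<le> ennreal (\<Sum>i\<in>{1..n}. real (cnt (c i) B \<omega>) ^ (q * n))"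
      by (intro ennreal_leI) (simp add: prod_power_distrib power_mult)
    then show "ennreal ((\<Prod>i\<in>{1..n}. real (cnt (c i) B \<omega>)) ^ q) \<le> (\<Sum>i\<in>{1..n}. ennreal (real (cnt (c i) B \<omega>) ^ (q * n)))"
      by (simp add: sum_ennreal)
  qed
  also have "\<dots> = (\<Sum>i\<in>{1..n}. \<integral>\<^sup>+\<omega>. ennreal (real (cnt (c i) B \<omega>) ^ (q * n)) \<partial>P)"
    by (intro nn_integral_sum measurable_compose[OF m]) auto
  also have "\<dots> \<le> (\<Sum>i\<in>{1..n}. ennreal (((2 * \<alpha> (c i)) ^ (q * n) + (2 * real (q * n)) ^ (q * n)) * measure \<mu> B ^ (q * n)))"
    by (intro sum_mono nn_integral_cnt_power_le c B)
  also have "\<dots> = ennreal (moment_const n c q * measure \<mu> B ^ (q * n))"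
    unfolding moment_const_def sum_distrib_right using c pos
    by (intro sum_ennreal mult_nonneg_nonneg add_nonneg_nonneg zero_le_power) (auto simp: less_imp_le)
  finally show ?thesis .
qed

lemma tuple_count_mono: "E \<subseteq> E' \<Longrightarrow> tuple_count n c E \<omega> \<le> tuple_count n c E' \<omega>"
  unfolding tuple_count_def by (intro emeasure_mono) auto

lemma nn_integral_tuple_count_finite:
  assumes n: "n \<ge> 1" and c: "\<And>i. i \<in> {1..n} \<Longrightarrow> c i \<in> C" and E: "E \<subseteq> cube n r"
  shows "(\<integral>\<^sup>+\<omega>. tuple_count n c E \<omega> \<partial>P) < \<infinity>"
proof -
  obtain r' where r': "r' \<ge> r" "1 \<le> mass r'"
    using mass_at_top unfolding filterlim_at_top eventually_sequentially by (meson nat_le_linear)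
  have "E \<subseteq> cube n r'" using E incseq_cube[of n] r'(1) unfolding incseq_def by blast
  then have "(\<integral>\<^sup>+\<omega>. tuple_count n c E \<omega> \<partial>P) \<le> (\<integral>\<^sup>+\<omega>. tuple_count n c (cube n r') \<omega> \<partial>P)"
    by (intro nn_integral_mono tuple_count_mono)
  also have "\<dots> = (\<integral>\<^sup>+\<omega>. ennreal ((\<Prod>i\<in>{1..n}. real (cnt (c i) (ball undefined (real r')) \<omega>)) ^ 1) \<partial>P)"
  proof (intro nn_integral_cong)
    fix \<omega> assume w: "\<omega> \<in> space P"
    have "tuple_count n c (cube n r') \<omega> = (\<Prod>i\<in>{1..n}. of_nat (cnt (c i) (ball undefined (real r')) \<omega>))"
      unfolding cube_def by (rule tuple_count_PiE[OF c w]) auto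
    then show "tuple_count n c (cube n r') \<omega> = ennreal ((\<Prod>i\<in>{1..n}. real (cnt (c i) (ball undefined (real r')) \<omega>)) ^ 1)"
      by (simp add: ennreal_of_nat_eq_real_of_nat prod_ennreal)
  qed
  also have "\<dots> \<le> ennreal (moment_const n c 1 * mass r' ^ (1 * n))"
    unfolding mass_def by (rule nn_integral_prod_cnt_le[OF n c]) (use r' in \<open>auto simp: mass_def\<close>)
  also have "\<dots> < \<infinity>" by simp
  finally show ?thesis .
qed

lemma moment_measure_boundedly_finite:
  assumes n: "n \<ge> 1" and c: "\<And>i. i \<in> {1..n} \<Longrightarrow> c i \<in> C"
  shows "boundedly_finite_power n (moment_measure n c)"
  unfolding boundedly_finite_power_def
proof (intro ballI impI)
  fix A :: "(nat \<Rightarrow> 'a) set"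
  assume A: "A \<in> sets (moment_measure n c)" and b: "\<forall>i\<in>{1..n}. bounded ((\<lambda>x. x i) ` A)"
  then have A': "A \<in> sets (power_algebra n)" by (simp add: sets_moment_measure)
  have "bounded (\<Union>i\<in>{1..n}. (\<lambda>x. x i) ` A)" using b by (intro bounded_UN) auto
  then have "\<exists>e. \<forall>y\<in>(\<Union>i\<in>{1..n}. (\<lambda>x. x i) ` A). dist undefined y \<le> e"
    by (rule iffD1[OF bounded_any_center])
  then obtain e where e: "\<forall>y\<in>(\<Union>i\<in>{1..n}. (\<lambda>x. x i) ` A). dist undefined y \<le> e" ..
  obtain r :: nat where r: "e < real r" using reals_Archimedean2 by blast
  have "A \<subseteq> cube n r"
  proof
    fix x assume x: "x \<in> A"
    then have "x \<in> space (power_algebra n)" using sets.sets_into_space[OF A'] by blast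
    moreover have "dist undefined (x i) < real r" if "i \<in> {1..n}" for i
    proof -
      have "x i \<in> (\<Union>i\<in>{1..n}. (\<lambda>x. x i) ` A)" using x that by blast
      then show ?thesis using e r by (meson le_less_trans)
    qed
    ultimately show "x \<in> cube n r" by (auto simp: cube_def space_power PiE_iff)
  qed
  then have "(\<integral>\<^sup>+\<omega>. tuple_count n c (orbit_free n \<inter> A) \<omega> \<partial>P) < \<infinity>"
    by (intro nn_integral_tuple_count_finite[OF n c, where r = r]) auto
  moreover have "emeasure (moment_measure n c) A = (\<integral>\<^sup>+\<omega>. tuple_count n c (orbit_free n \<inter> A) \<omega> \<partial>P)"
    by (rule emeasure_moment_measure[OF c A'])
  ultimately show "emeasure (moment_measure n c) A < \<infinity>" by simp
qed

lemma moment_measure_marginals: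
  assumes c: "\<And>i. i \<in> {1..n} \<Longrightarrow> c i \<in> C" and i: "i \<in> {1..n}"
  shows "absolutely_continuous \<mu> (distr (moment_measure n c) borel (\<lambda>x. x i))"
  unfolding absolutely_continuous_def
proof
  fix A assume "A \<in> null_sets \<mu>"
  then have A: "A \<in> sets borel" "emeasure \<mu> A = 0" by (auto simp: null_sets_def sets_mu)
  have m: "(\<lambda>x. x i) \<in> borel_measurable (power_algebra n :: (nat \<Rightarrow> 'a) measure)"
    unfolding power_algebra_def using i by (rule measurable_component_singleton)
  then have m': "(\<lambda>x. x i) \<in> borel_measurable (moment_measure n c)"
    by (simp add: measurable_cong_sets[OF sets_moment_measure refl])
  let ?E = "(\<lambda>x. x i) -` A \<inter> space (power_algebra n)"
  have E: "?E \<in> sets (power_algebra n)" using m A(1) by (rule measurable_sets)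
  have "AE \<omega> in P. point_count (N (c i) \<omega>) A = 0"
    using process[OF c[OF i]] A by (auto simp: T_point_process_def)
  then have "AE \<omega> in P. tuple_count n c (orbit_free n \<inter> ?E) \<omega> = 0"
  proof eventually_elim
    case (elim \<omega>)
    then have "N (c i) \<omega> \<inter> A = {}"
      by (cases "finite (N (c i) \<omega> \<inter> A)") (auto simp: point_count_def)
    then have "colour_tuples n c \<omega> \<inter> (orbit_free n \<inter> ?E) = {}"
      using i by (auto simp: colour_tuples_def)
    then show ?case by (simp add: tuple_count_def)
  qed
  then have "(\<integral>\<^sup>+\<omega>. tuple_count n c (orbit_free n \<inter> ?E) \<omega> \<partial>P) = (\<integral>\<^sup>+\<omega>. 0 \<partial>P)"
    by (rule nn_integral_cong_AE)
  moreover have "emeasure (moment_measure n c) ?E = (\<integral>\<^sup>+\<omega>. tuple_count n c (orbit_free n \<inter> ?E) \<omega> \<partial>P)"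
    by (rule emeasure_moment_measure[OF c E])
  ultimately have "emeasure (moment_measure n c) ?E = 0" by simp
  then show "A \<in> null_sets (distr (moment_measure n c) borel (\<lambda>x. x i))"
    using A m' by (auto simp: null_sets_def emeasure_distr space_moment_measure)
qed

lemma int_iterate_measurable [measurable]: "int_iterate UNIV T k \<in> measurable borel borel"
  by (simp add: int_iterate_def)

lemma orbit_freeD:
  "x \<in> orbit_free n \<Longrightarrow> i \<in> {1..n} \<Longrightarrow> j \<in> {1..n} \<Longrightarrow> i \<noteq> j \<Longrightarrow> x i \<noteq> (T ^^ k) (x j)"
  unfolding orbit_free_def by blast

lemma orbit_free_int_iterate:
  assumes x: "x \<in> orbit_free n" and ij: "i \<in> {1..n}" "j \<in> {1..n}" "i \<noteq> j"
  shows "int_iterate UNIV T k (x i) \<noteq> x j"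
proof (cases "0 \<le> k")
  case True
  then show ?thesis using orbit_freeD[OF x ij(2,1), of "nat k"] ij(3) by (auto simp: int_iterate_def)
next
  case False
  have "(T ^^ m) ((inv T ^^ m) y) = y" for m y
    using bij_T by (metis bij_fn bij_is_surj inv_fn surj_f_inv_f)
  then show ?thesis using orbit_freeD[OF x ij, of "nat (- k)"] False by (metis int_iterate_def)
qed

text \<open>A graph measure with a block of at least two indices lives on tuples with two entries on a common
  orbit. To see this from its values on rectangles alone, the complement of a graph is covered by
  countably many rectangles that miss the graph. If all blocks are singletons then all exponents are
  \<open>0\<close> by compatibility, and the formula for rectangles is that of the product measure.\<close>

lemma graph_measure_dichotomy:
  assumes m: "is_graph_measure \<mu> T n \<pi> \<kappa> m" and part: "partition_on {1..n} \<pi>" and comp: "compatible \<pi> \<kappa>"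
  shows "emeasure m (orbit_free n) = 0 \<or>
    (\<forall>B. (\<forall>i\<in>{1..n}. B i \<in> sets borel) \<longrightarrow> emeasure m (PiE {1..n} B) = (\<Prod>i\<in>{1..n}. emeasure \<mu> (B i)))"
proof (cases "\<exists>Q\<in>\<pi>. \<exists>j\<in>Q. j \<noteq> Min Q")
  case True
  have fin_\<pi>: "finite \<pi>" using part by (intro finite_elements) auto
  obtain Q j where Q: "Q \<in> \<pi>" "j \<in> Q" "j \<noteq> Min Q" using True by blast
  have Qn: "Q \<subseteq> {1..n}" using part Q(1) by (auto simp: partition_on_def)
  define i where "i = Min Q"
  have i: "i \<in> Q" unfolding i_def using Q(2) Qn by (intro Min_in) (auto intro: finite_subset)
  have \<kappa>i: "\<kappa> i = 0" using comp Q(1) by (simp add: compatible_def i_def)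
  have ij: "i \<noteq> j" using Q(3) by (simp add: i_def)
  obtain \<B> :: "'a set set" where \<B>: "countable \<B>" "topological_basis \<B>"
    using ex_countable_basis by blast
  let ?g = "int_iterate UNIV T (\<kappa> j)"
  define F where "F U V = PiE {1..n} (\<lambda>l. if l = i then ?g -` U else if l = j then V else UNIV)" for U V
  define I where "I = {(U, V) \<in> \<B> \<times> \<B>. U \<inter> V = {}}"
  have I: "countable I" unfolding I_def by (rule countable_subset[of _ "\<B> \<times> \<B>"]) (auto intro: \<B>)
  have null: "F U V \<in> null_sets m" if "(U, V) \<in> I" for U V
  proof -
    have UV: "open U" "open V" "U \<inter> V = {}"
      using that topological_basis_open[OF \<B>(2)] by (auto simp: I_def)
    let ?A = "\<lambda>l. if l = i then ?g -` U else if l = j then V else UNIV"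
    have A: "\<forall>l\<in>{1..n}. ?A l \<in> sets borel"
      using UV measurable_sets[OF int_iterate_measurable, of U] by auto
    have "(\<Inter>l\<in>Q. int_iterate UNIV T (\<kappa> l) -` ?A l) \<subseteq> int_iterate UNIV T (\<kappa> i) -` ?A i \<inter> int_iterate UNIV T (\<kappa> j) -` ?A j"
      using i Q(2) by blast
    also have "\<dots> = {}" using UV(3) ij \<kappa>i by (auto simp: int_iterate_def)
    finally have "emeasure \<mu> (\<Inter>l\<in>Q. int_iterate UNIV T (\<kappa> l) -` ?A l) = 0" by simp
    then have "(\<Prod>Q\<in>\<pi>. emeasure \<mu> (\<Inter>l\<in>Q. int_iterate UNIV T (\<kappa> l) -` ?A l)) = 0"
      using Q(1) fin_\<pi> by (intro prod_zero) blast+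
    then have "emeasure m (F U V) = 0"
      unfolding F_def using m A by (simp add: is_graph_measure_def)
    moreover have "F U V \<in> sets m"
    proof -
      have "F U V \<in> sets (power_algebra n)" unfolding F_def using A by (intro PiE_in_sets_power) blast
      then show ?thesis using m by (simp only: is_graph_measure_def)
    qed
    ultimately show ?thesis by (simp add: null_sets_def)
  qed
  have "orbit_free n \<subseteq> (\<Union>(U, V)\<in>I. F U V)"
  proof
    fix x assume x: "x \<in> orbit_free n"
    have "?g (x i) \<noteq> x j" using i Q(2) Qn ij by (intro orbit_free_int_iterate[OF x]) auto
    then obtain U0 V0 where U0: "open U0" "open V0" "?g (x i) \<in> U0" "x j \<in> V0" "U0 \<inter> V0 = {}"
      using hausdorff by metis
    obtain U where U: "U \<in> \<B>" "?g (x i) \<in> U" "U \<subseteq> U0" using topological_basisE[OF \<B>(2) U0(1,3)] .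
    obtain V where V: "V \<in> \<B>" "x j \<in> V" "V \<subseteq> V0" using topological_basisE[OF \<B>(2) U0(2,4)] .
    have "(U, V) \<in> I" using U V U0(5) by (auto simp: I_def)
    moreover have "x \<in> F U V" using x U(2) V(2) by (auto simp: F_def orbit_free_def space_power PiE_iff)
    ultimately show "x \<in> (\<Union>(U, V)\<in>I. F U V)" by blast
  qed
  moreover have "(\<Union>(U, V)\<in>I. F U V) \<in> null_sets m"
    using null by (intro null_sets_UN'[OF I]) auto
  ultimately have "emeasure m (orbit_free n) = 0"
    by (metis emeasure_mono le_zero_eq null_setsD1 null_setsD2)
  then show ?thesis ..
next
  case False
  have \<pi>: "Q = {Min Q}" if "Q \<in> \<pi>" for Q
  proof -
    have "Q \<noteq> {}" using that part by (auto simp: partition_on_def)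
    then obtain j where j: "j \<in> Q" by blast
    have a: "l = Min Q" if "l \<in> Q" for l using False \<open>Q \<in> \<pi>\<close> that by blast
    have "l \<in> Q \<longleftrightarrow> l \<in> {Min Q}" for l using a[of l] a[OF j] j by (metis singleton_iff)
    then show ?thesis by blast
  qed
  have "\<pi> = (\<lambda>i. {i}) ` {1..n}"
  proof (intro antisym subsetI)
    fix Q assume Q: "Q \<in> \<pi>"
    then have "Q \<subseteq> {1..n}" using part by (auto simp: partition_on_def)
    then show "Q \<in> (\<lambda>i. {i}) ` {1..n}" using \<pi>[OF Q] by (metis image_eqI insert_subset)
  next
    fix Q assume "Q \<in> (\<lambda>i. {i}) ` {1..n}"
    then obtain i where i: "i \<in> {1..n}" "Q = {i}" by auto
    then have "i \<in> \<Union>\<pi>" using part by (simp add: partition_on_def)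
    then obtain Q' where "Q' \<in> \<pi>" "i \<in> Q'" by blast
    then show "Q \<in> \<pi>" using \<pi>[of Q'] i by (metis singletonD)
  qed
  moreover have "\<kappa> i = 0" if "{i} \<in> \<pi>" for i using comp that by (auto simp: compatible_def)
  ultimately have "(\<Prod>Q\<in>\<pi>. emeasure \<mu> (\<Inter>l\<in>Q. int_iterate UNIV T (\<kappa> l) -` B l)) = (\<Prod>i\<in>{1..n}. emeasure \<mu> (B i))" for B
    by (simp add: prod.reindex int_iterate_def)
  then show ?thesis using m by (simp add: is_graph_measure_def)
qed

text \<open>Almost every ergodic component gives measure zero to the complement of the orbit-free tuples, as the
  moment measure does, so by the dichotomy it is a multiple of the product measure. Integrating the
  components preserves proportionality. The cross-multiplied form avoids naming the constant, which is
  convenient because rectangles of measure \<open>0\<close> or \<open>\<infinity>\<close> are included.\<close>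

lemma moment_measure_proportional:
  assumes n: "n \<ge> 1" and c: "\<And>i. i \<in> {1..n} \<Longrightarrow> c i \<in> C"
    and A: "\<And>i. i \<in> {1..n} \<Longrightarrow> A i \<in> sets borel" and B: "\<And>i. i \<in> {1..n} \<Longrightarrow> B i \<in> sets borel"
  shows "emeasure (moment_measure n c) (PiE {1..n} A) * (\<Prod>i\<in>{1..n}. emeasure \<mu> (B i))
    = emeasure (moment_measure n c) (PiE {1..n} B) * (\<Prod>i\<in>{1..n}. emeasure \<mu> (A i))"
proof -
  let ?\<sigma> = "moment_measure n c" and ?X = "power_algebra n :: (nat \<Rightarrow> 'a) measure"
  have "boundedly_finite_power n ?\<sigma>" by (rule moment_measure_boundedly_finite[OF n c])
  moreover have "preserves ?\<sigma> (power_map n T)" by (rule moment_measure_invariant[OF c])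
  moreover have "\<forall>i\<in>{1..n}. absolutely_continuous \<mu> (distr ?\<sigma> borel (\<lambda>x. x i))"
    by (intro ballI moment_measure_marginals c)
  ultimately obtain \<rho> where dec: "ergodic_decomposition n T ?\<sigma> \<rho>"
    and comp: "AE \<nu> in \<rho>. \<exists>\<pi> \<kappa> m (c::real). partition_on {1..n} \<pi> \<and> compatible \<pi> \<kappa> \<and>
                  is_graph_measure \<mu> T n \<pi> \<kappa> m \<and> 0 < c \<and> \<nu> = scale_measure (ennreal c) m"
    using P2[unfolded property_P2_def, rule_format, of n ?\<sigma>] n sets_moment_measure[of n c]
    by blast
  have sets_\<rho>: "sets \<rho> = sets (measures_algebra ?X)"
    and nz: "AE \<nu> in \<rho>. emeasure \<nu> (space \<nu>) \<noteq> 0"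
    and bary: "E \<in> sets ?X \<Longrightarrow> emeasure ?\<sigma> E = (\<integral>\<^sup>+\<nu>. emeasure \<nu> E \<partial>\<rho>)" for E
    using dec by (auto simp: ergodic_decomposition_def)
  have meas: "(\<lambda>\<nu>. emeasure \<nu> E) \<in> borel_measurable \<rho>" if "E \<in> sets ?X" for E
    using measurable_emeasure_measures_algebra[OF that] measurable_cong_sets[OF sets_\<rho> refl] by blast
  let ?D = "space ?X - orbit_free n"
  have D: "?D \<in> sets ?X" using orbit_free_sets by auto
  have "orbit_free n \<inter> ?D = {}" by auto
  moreover have "emeasure ?\<sigma> ?D = (\<integral>\<^sup>+\<omega>. tuple_count n c (orbit_free n \<inter> ?D) \<omega> \<partial>P)"
    by (rule emeasure_moment_measure[OF c D])
  ultimately have "emeasure ?\<sigma> ?D = 0" by (simp add: tuple_count_def)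
  then have "AE \<nu> in \<rho>. emeasure \<nu> ?D = 0"
    using bary[OF D] nn_integral_0_iff_AE[OF meas[OF D]] by simp
  with nz comp have "AE \<nu> in \<rho>. emeasure \<nu> (PiE {1..n} A) * (\<Prod>i\<in>{1..n}. emeasure \<mu> (B i))
      = emeasure \<nu> (PiE {1..n} B) * (\<Prod>i\<in>{1..n}. emeasure \<mu> (A i))"
  proof eventually_elim
    case (elim \<nu>)
    then obtain \<pi> \<kappa> m and a :: real where m: "partition_on {1..n} \<pi>" "compatible \<pi> \<kappa>"
      "is_graph_measure \<mu> T n \<pi> \<kappa> m" "\<nu> = scale_measure (ennreal a) m" by blast
    have sets_m: "sets m = sets ?X" using m(3) by (simp add: is_graph_measure_def)
    then have space_m: "space m = space ?X" by (rule sets_eq_imp_space_eq)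
    have "emeasure m (orbit_free n) \<noteq> 0"
    proof
      assume 0: "emeasure m (orbit_free n) = 0"
      have "emeasure \<nu> (space \<nu>) = emeasure \<nu> (orbit_free n \<union> ?D)"
        using sets.sets_into_space[OF orbit_free_sets] by (intro arg_cong[of _ _ "emeasure \<nu>"]) (auto simp: m(4) space_scale_measure space_m)
      also have "\<dots> \<le> emeasure \<nu> (orbit_free n) + emeasure \<nu> ?D"
        using orbit_free_sets D by (intro emeasure_subadditive) (auto simp: m(4) sets_m)
      also have "\<dots> = 0" using elim 0 by (simp add: m(4))
      finally show False using elim by simp
    qed
    then have "\<forall>B. (\<forall>i\<in>{1..n}. B i \<in> sets borel) \<longrightarrow> emeasure m (PiE {1..n} B) = (\<Prod>i\<in>{1..n}. emeasure \<mu> (B i))"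
      using graph_measure_dichotomy[OF m(3,1,2)] by blast
    then have "emeasure m (PiE {1..n} A) = (\<Prod>i\<in>{1..n}. emeasure \<mu> (A i))"
        "emeasure m (PiE {1..n} B) = (\<Prod>i\<in>{1..n}. emeasure \<mu> (B i))"
      using A B by blast+
    then show ?case by (simp only: m(4) emeasure_scale_measure ac_simps)
  qed
  then have "(\<integral>\<^sup>+\<nu>. emeasure \<nu> (PiE {1..n} A) * (\<Prod>i\<in>{1..n}. emeasure \<mu> (B i)) \<partial>\<rho>)
      = (\<integral>\<^sup>+\<nu>. emeasure \<nu> (PiE {1..n} B) * (\<Prod>i\<in>{1..n}. emeasure \<mu> (A i)) \<partial>\<rho>)"
    by (rule nn_integral_cong_AE)
  then show ?thesis
    using A B by (simp only: nn_integral_multc meas PiE_in_sets_power bary)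
qed

end

section \<open>No two points on a common orbit\<close>

lemma (in prob_space) AE_notin_if_small_covers:
  assumes "\<And>e. e > 0 \<Longrightarrow> \<exists>G\<in>events. X \<subseteq> G \<and> prob G \<le> e"
  shows "AE \<omega> in M. \<omega> \<notin> X"
proof -
  have "\<forall>m. \<exists>G. G \<in> events \<and> X \<subseteq> G \<and> prob G \<le> 1 / Suc m"
    using assms[of "1 / Suc m" for m] by (auto simp: Bex_def)
  then obtain G where G: "\<And>m. G m \<in> events" "\<And>m. X \<subseteq> G m" "\<And>m. prob (G m) \<le> 1 / Suc m" by metis
  have Gs: "(\<Inter>m. G m) \<in> events" using G(1) by auto
  have "prob (\<Inter>m. G m) \<le> 1 / Suc m" for m
    using finite_measure_mono[of "\<Inter>m. G m" "G m"] G(1,3)[of m] by (meson INT_lower UNIV_I order_trans)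
  then have "prob (\<Inter>m. G m) \<le> 0"
    using nat_approx_posE[of "prob (\<Inter>m. G m)"] by (meson not_le)
  then have "(\<Inter>m. G m) \<in> null_sets M"
    using Gs by (intro null_setsI) (auto simp: emeasure_eq_measure measure_le_0_iff)
  then show ?thesis using G(2) by (intro AE_I'[of "\<Inter>m. G m"]) auto
qed

context dissociated_poisson_processes
begin

text \<open>Since \<open>\<mu>\<close> has no atoms, small balls have small measure, and countably many basic sets inside such
  balls cover the space.\<close>

lemma small_partition:
  assumes "C \<noteq> {}" "e > 0"
  shows "\<exists>W :: nat \<Rightarrow> 'a set. (\<forall>j. W j \<in> sets borel \<and> emeasure \<mu> (W j) \<le> ennreal e) \<and>
    disjoint_family W \<and> (\<Union>j. W j) = UNIV"
proof -
  obtain \<B> :: "'a set set" where \<B>: "countable \<B>" "topological_basis \<B>"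
    using ex_countable_basis by blast
  define \<C> where "\<C> = {B\<in>\<B>. emeasure \<mu> B \<le> ennreal e}"
  have cover: "\<exists>B\<in>\<C>. x \<in> B" for x
  proof -
    have "(\<lambda>n. emeasure \<mu> (ball x (1 / Suc n))) \<longlonglongrightarrow> emeasure \<mu> (\<Inter>n. ball x (1 / Suc n))"
    proof (rule Lim_emeasure_decseq)
      show "decseq (\<lambda>n. ball x (1 / Suc n))"
        by (intro decseq_SucI subset_ball) (simp add: field_simps)
    qed (use emeasure_bounded_finite in \<open>auto simp: sets_mu less_top[symmetric]\<close>)
    also have "(\<Inter>n. ball x (1 / Suc n)) = {x}"
    proof -
      have "y = x" if "\<forall>n. dist x y < 1 / Suc n" for y
        using that nat_approx_posE[of "dist x y"] by (metis not_less_iff_gr_or_eq zero_less_dist_iff)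
      then show ?thesis by auto
    qed
    finally have "(\<lambda>n. emeasure \<mu> (ball x (1 / Suc n))) \<longlonglongrightarrow> 0"
      using emeasure_singleton[OF assms(1)] by simp
    then have "eventually (\<lambda>n. emeasure \<mu> (ball x (1 / Suc n)) < ennreal e) sequentially"
      by (rule order_tendstoD(2)) (use assms in simp)
    then obtain n where n: "emeasure \<mu> (ball x (1 / Suc n)) < ennreal e"
      by (auto simp: eventually_sequentially)
    obtain B where B: "B \<in> \<B>" "x \<in> B" "B \<subseteq> ball x (1 / Suc n)"
      using topological_basisE[OF \<B>(2), of "ball x (1 / Suc n)" x] by auto
    have "emeasure \<mu> B \<le> emeasure \<mu> (ball x (1 / Suc n))"
      using B(3) by (intro emeasure_mono) (auto simp: sets_mu)
    then show ?thesis using B n by (auto simp: \<C>_def)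
  qed
  define Y where "Y = from_nat_into \<C>"
  have ne: "\<C> \<noteq> {}" using cover by auto
  have co: "countable \<C>" using \<B>(1) by (auto simp: \<C>_def)
  have Y: "Y j \<in> \<C>" for j unfolding Y_def using ne by (rule from_nat_into)
  have Yb: "Y j \<in> sets borel" for j
    using Y[of j] topological_basis_open[OF \<B>(2)] by (auto simp: \<C>_def)
  show ?thesis
  proof (intro exI[of _ "disjointed Y"] conjI allI)
    show "disjointed Y j \<in> sets borel" for j
      using sets.range_disjointed_sets[of Y borel] Yb by auto
    have "emeasure \<mu> (disjointed Y j) \<le> emeasure \<mu> (Y j)" for j
      using Yb by (intro emeasure_mono disjointed_subset) (simp add: sets_mu)
    then show "emeasure \<mu> (disjointed Y j) \<le> ennreal e" for j
      using Y[of j] by (auto simp: \<C>_def intro: order_trans)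
    show "disjoint_family (disjointed Y)" by (rule disjoint_family_disjointed)
    show "(\<Union>j. disjointed Y j) = UNIV"
    proof -
      have "\<exists>j. x \<in> Y j" for x
      proof -
        obtain B where B: "B \<in> \<C>" "x \<in> B" using cover by blast
        obtain j where "from_nat_into \<C> j = B" using from_nat_into_surj[OF co B(1)] by blast
        then show ?thesis using B(2) unfolding Y_def by blast
      qed
      then show ?thesis unfolding UN_disjointed_eq by blast
    qed
  qed
qed

text \<open>Cut \<open>U\<close> into pieces \<open>U' j\<close> of measure at most \<open>\<epsilon>\<close>. A point \<open>x\<close> with \<open>(T ^^ k) x\<close> in \<open>U' j\<close> lies
  in the pullback \<open>V' j\<close>, which is disjoint from \<open>U' j\<close> and has at most the same measure. As the counts
  on disjoint sets are independent, both pieces are occupied with probability at most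
  \<open>\<alpha>\<^sup>2 \<epsilon> \<mu>(U' j)\<close>, and these bounds add up to \<open>\<alpha>\<^sup>2 \<epsilon> \<mu>(U)\<close>.\<close>

lemma AE_no_orbit_pair:
  assumes c: "c \<in> C" and U: "U \<in> sets borel" "bounded U" and V: "V \<in> sets borel" "bounded V"
    and disj: "U \<inter> V = {}"
  shows "AE \<omega> in P. \<forall>x\<in>N c \<omega> \<inter> V. (T ^^ k) x \<notin> N c \<omega> \<inter> U"
proof -
  define X where "X = {\<omega>\<in>space P. \<exists>x\<in>N c \<omega> \<inter> V. (T ^^ k) x \<in> N c \<omega> \<inter> U}"
  have "AE \<omega> in P. \<omega> \<notin> X"
  proof (rule AE_notin_if_small_covers)
    fix e :: real assume e: "e > 0"
    \<comment> \<open>The summand 1 only keeps the divisor positive when \<open>\<mu>(U) = 0\<close>.\<close>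
    define K where "K = (\<alpha> c)\<^sup>2 * measure \<mu> U + 1"
    have K: "K > 0" by (auto simp: K_def intro!: add_nonneg_pos)
    have Cne: "C \<noteq> {}" and eK: "0 < e / K" using c e K by auto
    obtain W :: "nat \<Rightarrow> 'a set" where W0: "\<forall>j. W j \<in> sets borel \<and> emeasure \<mu> (W j) \<le> ennreal (e / K)"
      and W34: "disjoint_family W" "(\<Union>j. W j) = UNIV"
      using small_partition[OF Cne eK] by blast
    have W: "W j \<in> sets borel" "emeasure \<mu> (W j) \<le> ennreal (e / K)" for j using W0 by auto
    define U' where "U' j = U \<inter> W j" for j
    define V' where "V' j = V \<inter> (T ^^ k) -` (U' j)" for j
    have U': "U' j \<in> sets borel" "bounded (U' j)" for j
      using U W(1) by (auto simp: U'_def intro: bounded_subset)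
    have V': "V' j \<in> sets borel" "bounded (V' j)" for j
      using V vimage_T_power_borel[OF U'(1)] by (auto simp: V'_def intro: bounded_subset)
    have mU': "measure \<mu> (U' j) \<le> e / K" for j
    proof -
      have "emeasure \<mu> (U' j) \<le> emeasure \<mu> (W j)"
        using W(1) by (intro emeasure_mono) (auto simp: U'_def sets_mu)
      then have "ennreal (measure \<mu> (U' j)) \<le> ennreal (e / K)"
        using W(2)[of j] emeasure_bounded[OF U'] by (auto intro: order_trans)
      then show ?thesis using eK by (simp add: ennreal_le_iff)
    qed
    have mV': "measure \<mu> (V' j) \<le> measure \<mu> (U' j)" for j
    proof -
      have "emeasure \<mu> (V' j) \<le> emeasure \<mu> ((T ^^ k) -` (U' j))"
        using vimage_T_power_borel[OF U'(1)] by (intro emeasure_mono) (auto simp: V'_def sets_mu)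
      then show ?thesis
        unfolding emeasure_vimage_T_power[OF U'(1)] emeasure_bounded[OF U'] emeasure_bounded[OF V']
        by (simp add: ennreal_le_iff)
    qed
    define G where "G j = {\<omega>\<in>space P. cnt c (V' j) \<omega> \<noteq> 0 \<and> cnt c (U' j) \<omega> \<noteq> 0}" for j
    have Gs: "G j \<in> events" for j
    proof -
      have [measurable]: "cnt c (V' j) \<in> measurable P (count_space UNIV)" "cnt c (U' j) \<in> measurable P (count_space UNIV)"
        using cnt_measurable c U' V' by auto
      show ?thesis unfolding G_def by measurable
    qed
    have Gp: "emeasure P (G j) \<le> ennreal ((\<alpha> c)\<^sup>2 * (e / K)) * emeasure \<mu> (U' j)" for j
    proof -
      have "prob (G j) \<le> (\<alpha> c * measure \<mu> (V' j)) * (\<alpha> c * measure \<mu> (U' j))"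
        unfolding G_def using c V' U' disj by (intro prob_cnt_pair_le) (auto simp: V'_def U'_def)
      also have "\<dots> = (\<alpha> c)\<^sup>2 * measure \<mu> (V' j) * measure \<mu> (U' j)"
        by (simp add: power2_eq_square)
      also have "\<dots> \<le> (\<alpha> c)\<^sup>2 * (e / K) * measure \<mu> (U' j)"
        using mV'[of j] mU'[of j] by (intro mult_right_mono mult_left_mono) auto
      finally have "ennreal (prob (G j)) \<le> ennreal ((\<alpha> c)\<^sup>2 * (e / K) * measure \<mu> (U' j))"
        by (rule ennreal_leI)
      also have "\<dots> = ennreal ((\<alpha> c)\<^sup>2 * (e / K)) * ennreal (measure \<mu> (U' j))"
        using eK by (intro ennreal_mult mult_nonneg_nonneg) auto
      finally show ?thesis unfolding emeasure_bounded[OF U'] emeasure_eq_measure .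
    qed
    have "emeasure P (\<Union>j. G j) \<le> (\<Sum>j. emeasure P (G j))"
      using Gs by (intro emeasure_subadditive_countably) auto
    also have "\<dots> \<le> (\<Sum>j. ennreal ((\<alpha> c)\<^sup>2 * (e / K)) * emeasure \<mu> (U' j))"
      by (intro suminf_le Gp) auto
    also have "\<dots> = ennreal ((\<alpha> c)\<^sup>2 * (e / K)) * (\<Sum>j. emeasure \<mu> (U' j))" by simp
    also have "(\<Sum>j. emeasure \<mu> (U' j)) = emeasure \<mu> (\<Union>j. U' j)"
      using W34(1) U' by (intro suminf_emeasure) (auto simp: sets_mu U'_def disjoint_family_on_def)
    also have "(\<Union>j. U' j) = U" using W34(2) by (auto simp: U'_def)
    also have "ennreal ((\<alpha> c)\<^sup>2 * (e / K)) * emeasure \<mu> U = ennreal ((\<alpha> c)\<^sup>2 * measure \<mu> U / K * e)"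
    proof -
      have "ennreal ((\<alpha> c)\<^sup>2 * (e / K)) * ennreal (measure \<mu> U) = ennreal ((\<alpha> c)\<^sup>2 * (e / K) * measure \<mu> U)"
        using eK by (intro ennreal_mult[symmetric] mult_nonneg_nonneg) auto
      then show ?thesis unfolding emeasure_bounded[OF U] by (simp add: ac_simps)
    qed
    also have "\<dots> \<le> ennreal e"
    proof (rule ennreal_leI)
      have "(\<alpha> c)\<^sup>2 * measure \<mu> U / K \<le> 1" using K by (simp add: K_def)
      then show "(\<alpha> c)\<^sup>2 * measure \<mu> U / K * e \<le> e"
        using mult_right_mono[of _ 1 e] e by (simp only: mult_1)
    qed
    finally have "prob (\<Union>j. G j) \<le> e" using e by (simp add: emeasure_eq_measure)
    moreover have "X \<subseteq> (\<Union>j. G j)"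
    proof
      fix \<omega> assume "\<omega> \<in> X"
      then obtain x where w: "\<omega> \<in> space P" and x: "x \<in> N c \<omega> \<inter> V" "(T ^^ k) x \<in> N c \<omega> \<inter> U"
        by (auto simp: X_def)
      obtain j where "(T ^^ k) x \<in> W j" using W34(2) by blast
      then have "x \<in> N c \<omega> \<inter> V' j" "(T ^^ k) x \<in> N c \<omega> \<inter> U' j" using x by (auto simp: V'_def U'_def)
      moreover have "finite (N c \<omega> \<inter> V' j)" "finite (N c \<omega> \<inter> U' j)" using finite_N[OF c w] U' V' by auto
      ultimately have "cnt c (V' j) \<omega> \<noteq> 0" "cnt c (U' j) \<omega> \<noteq> 0"
        unfolding cnt_def by (metis card_eq_0_iff empty_iff)+
      then have "\<omega> \<in> G j" using w by (simp add: G_def)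
      then show "\<omega> \<in> (\<Union>j. G j)" by blast
    qed
    ultimately show "\<exists>G\<in>events. X \<subseteq> G \<and> prob G \<le> e" using Gs by blast
  qed
  then show ?thesis by (rule AE_mp) (auto simp: X_def)
qed

text \<open>Two different points are separated by disjoint bounded sets from a countable family.\<close>

lemma AE_same_colour:
  assumes c: "c \<in> C"
  shows "AE \<omega> in P. \<forall>x\<in>N c \<omega>. \<forall>k. (T ^^ k) x \<in> N c \<omega> \<longrightarrow> (T ^^ k) x = x"
proof -
  obtain \<B> :: "'a set set" where \<B>: "countable \<B>" "topological_basis \<B>"
    using ex_countable_basis by blast
  define I where "I = {(U, V, r, k). U \<in> \<B> \<and> V \<in> \<B> \<and> U \<inter> V = {} \<and> r \<in> (UNIV :: nat set) \<and> k \<in> (UNIV :: nat set)}"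
  have I: "countable I"
    by (rule countable_subset[of _ "\<B> \<times> \<B> \<times> UNIV \<times> UNIV"]) (auto simp: I_def intro: \<B>(1))
  have "AE \<omega> in P. \<forall>(U, V, r, k)\<in>I. \<forall>x\<in>N c \<omega> \<inter> (V \<inter> ball undefined (real r)). (T ^^ k) x \<notin> N c \<omega> \<inter> (U \<inter> ball undefined (real r))"
    unfolding AE_ball_countable[OF I]
  proof (clarify)
    fix U V r k assume "(U, V, r, k) \<in> I"
    then have UV: "open U" "open V" "U \<inter> V = {}" using topological_basis_open[OF \<B>(2)] by (auto simp: I_def)
    show "AE \<omega> in P. \<forall>x\<in>N c \<omega> \<inter> (V \<inter> ball undefined (real r)). (T ^^ k) x \<notin> N c \<omega> \<inter> (U \<inter> ball undefined (real r))"
      using UV by (intro AE_no_orbit_pair c) auto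
  qed
  then show ?thesis
  proof eventually_elim
    case (elim \<omega>)
    show ?case
    proof (intro ballI allI impI, rule ccontr)
      fix x k assume x: "x \<in> N c \<omega>" "(T ^^ k) x \<in> N c \<omega>" "(T ^^ k) x \<noteq> x"
      obtain U0 V0 where U0: "open U0" "open V0" "(T ^^ k) x \<in> U0" "x \<in> V0" "U0 \<inter> V0 = {}"
        using hausdorff[OF x(3)] by metis
      obtain U where U: "U \<in> \<B>" "(T ^^ k) x \<in> U" "U \<subseteq> U0" using topological_basisE[OF \<B>(2) U0(1,3)] .
      obtain V where V: "V \<in> \<B>" "x \<in> V" "V \<subseteq> V0" using topological_basisE[OF \<B>(2) U0(2,4)] .
      obtain r :: nat where r: "max (dist undefined x) (dist undefined ((T ^^ k) x)) < real r"
        using reals_Archimedean2 by blast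
      have "(U, V, r, k) \<in> I" using U V U0(5) by (auto simp: I_def)
      then have "\<forall>x\<in>N c \<omega> \<inter> (V \<inter> ball undefined (real r)). (T ^^ k) x \<notin> N c \<omega> \<inter> (U \<inter> ball undefined (real r))"
        using elim by blast
      then show False using x(1,2) U(2) V(2) r by auto
    qed
  qed
qed

lemma AE_different_colours:
  assumes c: "c \<in> C" and d: "d \<in> C" and cd: "c \<noteq> d"
  shows "AE \<omega> in P. \<forall>x\<in>N c \<omega>. \<forall>y\<in>N d \<omega>. \<forall>k. x \<noteq> (T ^^ k) y"
proof -
  have "AE \<omega> in P. \<forall>k::int. N c \<omega> \<inter> N d (int_iterate (space P) S k \<omega>) = {}"
    using dissoc[OF c d cd] by (simp add: dissociated_def)
  with AE_N_S_power[OF d] show ?thesis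
  proof eventually_elim
    case (elim \<omega>)
    have "N c \<omega> \<inter> (T ^^ k) ` N d \<omega> = {}" for k
      using elim(1)[rule_format, of k] elim(2)[rule_format, of "int k"] by (simp add: int_iterate_def)
    then show ?case by blast
  qed
qed

text \<open>The sample points that are good for all colours at once: points of the processes on a common orbit
  are equal and have the same colour.\<close>

definition dissociated_at :: "'w \<Rightarrow> bool" where
  "dissociated_at \<omega> \<longleftrightarrow> (\<forall>c\<in>C. \<forall>d\<in>C. \<forall>x\<in>N c \<omega>. \<forall>y\<in>N d \<omega>. \<forall>k. x = (T ^^ k) y \<longrightarrow> c = d \<and> x = y)"

lemma AE_dissociated_at: "AE \<omega> in P. dissociated_at \<omega>"
proof -
  have "AE \<omega> in P. \<forall>c\<in>C. \<forall>d\<in>C. \<forall>x\<in>N c \<omega>. \<forall>y\<in>N d \<omega>. \<forall>k. x = (T ^^ k) y \<longrightarrow> c = d \<and> x = y"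
  proof (intro AE_finite_allI finite_C)
    fix c d assume cd: "c \<in> C" "d \<in> C"
    show "AE \<omega> in P. \<forall>x\<in>N c \<omega>. \<forall>y\<in>N d \<omega>. \<forall>k. x = (T ^^ k) y \<longrightarrow> c = d \<and> x = y"
    proof (cases "c = d")
      case True
      show ?thesis using AE_same_colour[OF cd(1)] by eventually_elim (use True in auto)
    next
      case False
      show ?thesis using AE_different_colours[OF cd False] by eventually_elim auto
    qed
  qed
  then show ?thesis by (simp add: dissociated_at_def)
qed

lemma dissociated_at_disjoint:
  assumes "dissociated_at \<omega>" "c \<in> C" "d \<in> C" "c \<noteq> d"
  shows "N c \<omega> \<inter> N d \<omega> = {}"
proof -
  have "x = y \<longrightarrow> c = d" if "x \<in> N c \<omega>" "y \<in> N d \<omega>" for x y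
    using assms(1)[unfolded dissociated_at_def, rule_format, of c d x y 0] assms that by auto
  then show ?thesis using assms(4) by blast
qed

section \<open>Factorial moments\<close>

definition fact_count :: "nat \<Rightarrow> (nat \<Rightarrow> nat) \<Rightarrow> (nat \<Rightarrow> 'a set) \<Rightarrow> 'w \<Rightarrow> real" where
  "fact_count n c B \<omega> = real (card (inj_tuples n (\<lambda>i. N (c i) \<omega> \<inter> B (c i))))"

lemma fact_count_nonneg: "0 \<le> fact_count n c B \<omega>"
  by (simp add: fact_count_def)

lemma fact_count_eq_tuple_count:
  assumes c: "\<And>i. i \<in> {1..n} \<Longrightarrow> c i \<in> C" and B: "\<And>i. i \<in> C \<Longrightarrow> bounded (B i)" and w: "\<omega> \<in> space P"
  shows "ennreal (fact_count n c B \<omega>) = tuple_count n c ({x. inj_on x {1..n}} \<inter> PiE {1..n} (\<lambda>i. B (c i))) \<omega>"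
proof -
  have "colour_tuples n c \<omega> \<inter> ({x. inj_on x {1..n}} \<inter> PiE {1..n} (\<lambda>i. B (c i))) = inj_tuples n (\<lambda>i. N (c i) \<omega> \<inter> B (c i))"
    using colour_tuples_Int_PiE[of n c \<omega> "\<lambda>i. B (c i)"] by (auto simp: inj_tuples_def)
  moreover have "finite (inj_tuples n (\<lambda>i. N (c i) \<omega> \<inter> B (c i)))"
    using c B w by (intro finite_inj_tuples finite_N) auto
  ultimately show ?thesis
    by (simp add: fact_count_def tuple_count_def ennreal_of_nat_eq_real_of_nat)
qed

text \<open>Injectivity of a tuple is a measurable condition, so this count is one of the tuple counts above. It
  agrees with the orbit-free count only almost surely, which is why it is treated separately.\<close>

lemma fact_count_measurable:
  assumes c: "\<And>i. i \<in> {1..n} \<Longrightarrow> c i \<in> C" and B: "\<And>i. i \<in> C \<Longrightarrow> B i \<in> sets borel" "\<And>i. i \<in> C \<Longrightarrow> bounded (B i)"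
  shows "fact_count n c B \<in> borel_measurable P"
proof -
  let ?E = "{x. inj_on x {1..n}} \<inter> PiE {1..n} (\<lambda>i. B (c i))"
  have [measurable]: "(\<lambda>x. x i) \<in> borel_measurable (power_algebra n :: (nat \<Rightarrow> 'a) measure)" if "i \<in> {1..n}" for i
    unfolding power_algebra_def using that by (rule measurable_component_singleton)
  have PiE: "PiE {1..n} (\<lambda>i. B (c i)) \<in> sets (power_algebra n)"
    using c B by (intro PiE_in_sets_power) auto
  have "{x \<in> space (power_algebra n). x i = x j} \<in> sets (power_algebra n :: (nat \<Rightarrow> 'a) measure)"
    if "i \<in> {1..n}" "j \<in> {1..n}" for i j
    using that by (intro measurable_equality_set) auto
  then have "PiE {1..n} (\<lambda>i. B (c i)) - (\<Union>i\<in>{1..n}. \<Union>j\<in>{1..n} - {i}.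
      {x \<in> space (power_algebra n). x i = x j}) \<in> sets (power_algebra n)"
    by (intro sets.Diff sets.finite_UN PiE) auto
  then have E: "?E \<in> sets (power_algebra n)"
    using sets.sets_into_space[OF PiE]
    by (elim back_subst[of "\<lambda>E. E \<in> sets (power_algebra n)"]) (auto simp: inj_on_def)
  have "fact_count n c B \<omega> = enn2real (tuple_count n c ?E \<omega>)" if "\<omega> \<in> space P" for \<omega>
  proof -
    have "ennreal (fact_count n c B \<omega>) = tuple_count n c ?E \<omega>"
      by (rule fact_count_eq_tuple_count[OF c B(2) that])
    then show ?thesis by (metis enn2real_ennreal fact_count_nonneg)
  qed
  then show ?thesis
    using tuple_count_measurable[OF c E] by (simp cong: measurable_cong)
qed

text \<open>For good sample points an injective tuple of points is automatically orbit-free.\<close>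

lemma nn_integral_fact_count:
  assumes c: "\<And>i. i \<in> {1..n} \<Longrightarrow> c i \<in> C" and B: "\<And>i. i \<in> C \<Longrightarrow> B i \<in> sets borel" "\<And>i. i \<in> C \<Longrightarrow> bounded (B i)"
  shows "(\<integral>\<^sup>+\<omega>. ennreal (fact_count n c B \<omega>) \<partial>P) = emeasure (moment_measure n c) (PiE {1..n} (\<lambda>i. B (c i)))"
proof -
  let ?E = "PiE {1..n} (\<lambda>i. B (c i))"
  have "AE \<omega> in P. ennreal (fact_count n c B \<omega>) = tuple_count n c (orbit_free n \<inter> ?E) \<omega>"
    using AE_dissociated_at AE_space
  proof eventually_elim
    case (elim \<omega>)
    have iff: "x \<in> orbit_free n \<longleftrightarrow> inj_on x {1..n}" if x: "x \<in> colour_tuples n c \<omega>" for x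
    proof
      assume "x \<in> orbit_free n"
      then have "x i \<noteq> x j" if "i \<in> {1..n}" "j \<in> {1..n}" "i \<noteq> j" for i j
        using orbit_freeD[of x n i j 0] that by simp
      then show "inj_on x {1..n}" unfolding inj_on_def by blast
    next
      assume inj: "inj_on x {1..n}"
      have "x i \<noteq> (T ^^ k) (x j)" if ij: "i \<in> {1..n}" "j \<in> {1..n}" "i \<noteq> j" for i j k
      proof
        assume eq: "x i = (T ^^ k) (x j)"
        have "x i \<in> N (c i) \<omega>" "x j \<in> N (c j) \<omega>" using x ij by (auto simp: colour_tuples_def)
        then have "x i = x j"
          using elim(1) eq c[OF ij(1)] c[OF ij(2)] unfolding dissociated_at_def by blast
        then show False using inj_onD[OF inj _ ij(1,2)] ij(3) by metis
      qed
      moreover have "x \<in> space (power_algebra n)" using x by (auto simp: colour_tuples_def space_power)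
      ultimately show "x \<in> orbit_free n" unfolding orbit_free_def by blast
    qed
    have "colour_tuples n c \<omega> \<inter> (orbit_free n \<inter> ?E) = colour_tuples n c \<omega> \<inter> ({x. inj_on x {1..n}} \<inter> ?E)"
      using iff by (intro set_eqI) (metis Int_iff mem_Collect_eq)
    moreover have "ennreal (fact_count n c B \<omega>) = tuple_count n c ({x. inj_on x {1..n}} \<inter> ?E) \<omega>"
      by (rule fact_count_eq_tuple_count[OF c B(2) elim(2)])
    ultimately show ?case by (simp only: tuple_count_def)
  qed
  then have "(\<integral>\<^sup>+\<omega>. ennreal (fact_count n c B \<omega>) \<partial>P) = (\<integral>\<^sup>+\<omega>. tuple_count n c (orbit_free n \<inter> ?E) \<omega> \<partial>P)"
    by (rule nn_integral_cong_AE)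
  also have "\<dots> = emeasure (moment_measure n c) ?E"
    using c B by (intro emeasure_moment_measure[symmetric] PiE_in_sets_power) auto
  finally show ?thesis .
qed

end

context dissociated_poisson_processes
begin

text \<open>The constant \<open>a\<close> is read off from one large cube. It depends only on the colours \<open>c\<close> and not on the
  sets, which makes it possible to compute it from balls of increasing radius.\<close>

lemma fact_count_moment_exists:
  assumes c: "\<And>i. i \<in> {1..n} \<Longrightarrow> c i \<in> C"
  shows "\<exists>a\<ge>0. \<forall>B. (\<forall>d\<in>C. B d \<in> sets borel \<and> bounded (B d)) \<longrightarrow>
    (\<integral>\<^sup>+\<omega>. ennreal (fact_count n c B \<omega>) \<partial>P) = ennreal (a * (\<Prod>i\<in>{1..n}. measure \<mu> (B (c i))))"
proof (cases "n = 0")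
  case True
  then show ?thesis using True by (intro exI[of _ 1]) (simp add: fact_count_def inj_tuples_0 emeasure_space_1)
next
  case False
  then have n: "n \<ge> 1" by simp
  let ?\<sigma> = "moment_measure n c"
  obtain r where r: "1 \<le> mass r"
    using mass_at_top unfolding filterlim_at_top eventually_sequentially by blast
  have fin: "emeasure ?\<sigma> E < \<infinity>" if "E \<in> sets (power_algebra n)" "\<forall>i\<in>{1..n}. bounded ((\<lambda>x. x i) ` E)" for E
  proof -
    have "boundedly_finite_power n ?\<sigma>" by (rule moment_measure_boundedly_finite[OF n c])
    then show ?thesis using that unfolding boundedly_finite_power_def sets_moment_measure by blast
  qed
  have bdd: "\<forall>i\<in>{1..n}. bounded ((\<lambda>x. x i) ` PiE {1..n} D)" if "\<And>i. i \<in> {1..n} \<Longrightarrow> bounded (D i)" for D :: "nat \<Rightarrow> 'a set"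
  proof
    fix i assume i: "i \<in> {1..n}"
    show "bounded ((\<lambda>x. x i) ` PiE {1..n} D)"
      by (rule bounded_subset[OF that[OF i]]) (rule image_subsetI, erule PiE_mem[OF _ i])
  qed
  define s where "s = measure ?\<sigma> (cube n r)"
  have s: "emeasure ?\<sigma> (cube n r) = ennreal s"
  proof -
    have "emeasure ?\<sigma> (cube n r) < \<infinity>"
      by (rule fin[OF cube_sets]) (unfold cube_def, rule bdd, rule bounded_ball)
    then show ?thesis unfolding s_def by (intro emeasure_eq_ennreal_measure) auto
  qed
  show ?thesis
  proof (intro exI[of _ "s / mass r ^ n"] conjI allI impI)
    show "0 \<le> s / mass r ^ n" by (simp add: s_def mass_def)
    fix B :: "nat \<Rightarrow> 'a set" assume B: "\<forall>d\<in>C. B d \<in> sets borel \<and> bounded (B d)"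
    let ?E = "PiE {1..n} (\<lambda>i. B (c i))"
    have E: "?E \<in> sets (power_algebra n)" using c B by (intro PiE_in_sets_power) auto
    define t where "t = measure ?\<sigma> ?E"
    have nonneg: "0 \<le> s" "0 \<le> t" by (simp_all add: s_def t_def)
    have t: "emeasure ?\<sigma> ?E = ennreal t"
      unfolding t_def using fin[OF E] bdd[of "\<lambda>i. B (c i)"] B c
      by (intro emeasure_eq_ennreal_measure) auto
    have "emeasure ?\<sigma> ?E * (\<Prod>i\<in>{1..n}. emeasure \<mu> (ball undefined (real r)))
        = emeasure ?\<sigma> (cube n r) * (\<Prod>i\<in>{1..n}. emeasure \<mu> (B (c i)))"
      unfolding cube_def using n c B by (intro moment_measure_proportional) auto
    moreover have "(\<Prod>i\<in>{1..n}. emeasure \<mu> (B (c i))) = ennreal (\<Prod>i\<in>{1..n}. measure \<mu> (B (c i)))"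
      using c B by (subst prod_ennreal[symmetric]) (auto intro!: prod.cong emeasure_bounded)
    ultimately have "ennreal t * ennreal (mass r) ^ n = ennreal s * ennreal (\<Prod>i\<in>{1..n}. measure \<mu> (B (c i)))"
      unfolding s t emeasure_ball by simp
    then have "ennreal (t * mass r ^ n) = ennreal (s * (\<Prod>i\<in>{1..n}. measure \<mu> (B (c i))))"
      using r nonneg by (simp add: ennreal_power ennreal_mult' prod_nonneg)
    then have "t * mass r ^ n = s * (\<Prod>i\<in>{1..n}. measure \<mu> (B (c i)))"
      using r nonneg by (subst (asm) ennreal_inj) (auto intro!: mult_nonneg_nonneg prod_nonneg)
    then have "t = s / mass r ^ n * (\<Prod>i\<in>{1..n}. measure \<mu> (B (c i)))"
      using r by (simp add: field_simps)
    moreover have "(\<integral>\<^sup>+\<omega>. ennreal (fact_count n c B \<omega>) \<partial>P) = ennreal t"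
      using nn_integral_fact_count[of n c B] c B t by simp
    ultimately show "(\<integral>\<^sup>+\<omega>. ennreal (fact_count n c B \<omega>) \<partial>P) = ennreal (s / mass r ^ n * (\<Prod>i\<in>{1..n}. measure \<mu> (B (c i))))"
      by simp
  qed
qed

lemma fact_count_Suc:
  assumes c: "\<And>i. i \<in> {1..Suc n} \<Longrightarrow> c i \<in> C" and B: "\<And>d. d \<in> C \<Longrightarrow> bounded (B d)"
    and w: "\<omega> \<in> space P" "dissociated_at \<omega>"
  shows "fact_count (Suc n) c B \<omega>
    = fact_count n c B \<omega> * (real (cnt (c (Suc n)) (B (c (Suc n))) \<omega>) - real (card {j\<in>{1..n}. c j = c (Suc n)}))"
  unfolding fact_count_def cnt_def
proof (rule card_inj_tuples_Suc)
  show "finite (N (c i) \<omega> \<inter> B (c i))" if "i \<in> {1..Suc n}" for i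
    using c[OF that] B w by (intro finite_N) auto
  show "N (c j) \<omega> \<inter> B (c j) \<inter> (N (c (Suc n)) \<omega> \<inter> B (c (Suc n))) = {}"
    if "j \<in> {1..n} - {j\<in>{1..n}. c j = c (Suc n)}" for j
    using dissociated_at_disjoint[OF w(2), of "c j" "c (Suc n)"] c that by auto
qed auto

lemma fact_count_le_prod:
  assumes c: "\<And>i. i \<in> {1..n} \<Longrightarrow> c i \<in> C" and B: "\<And>d. d \<in> C \<Longrightarrow> bounded (B d)" and w: "\<omega> \<in> space P"
  shows "fact_count n c B \<omega> \<le> (\<Prod>i\<in>{1..n}. real (cnt (c i) (B (c i)) \<omega>))"
proof -
  have "card (inj_tuples n (\<lambda>i. N (c i) \<omega> \<inter> B (c i))) \<le> (\<Prod>i\<in>{1..n}. card (N (c i) \<omega> \<inter> B (c i)))"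
    using c B w by (intro card_inj_tuples_le finite_N) auto
  then have "real (card (inj_tuples n (\<lambda>i. N (c i) \<omega> \<inter> B (c i)))) \<le> real (\<Prod>i\<in>{1..n}. card (N (c i) \<omega> \<inter> B (c i)))"
    by (rule of_nat_mono)
  then show ?thesis by (simp add: fact_count_def cnt_def)
qed

lemma fact_count_square_le:
  assumes c: "\<And>i. i \<in> {1..n} \<Longrightarrow> c i \<in> C" and r: "1 \<le> mass r"
  defines "F \<equiv> fact_count n c (\<lambda>_. ball undefined (real r))"
  shows "integrable P (\<lambda>\<omega>. (F \<omega>)\<^sup>2)" and "(\<integral>\<omega>. (F \<omega>)\<^sup>2 \<partial>P) \<le> (1 + moment_const n c 2) * mass r ^ (2 * n)"
proof -
  have F: "F \<in> borel_measurable P" unfolding F_def by (rule fact_count_measurable[OF c]) auto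
  have K: "0 \<le> moment_const n c 2" unfolding moment_const_def using c pos
    by (intro sum_nonneg add_nonneg_nonneg zero_le_power mult_nonneg_nonneg) (auto simp: less_imp_le)
  have "(\<integral>\<^sup>+\<omega>. ennreal ((F \<omega>)\<^sup>2) \<partial>P) \<le> ennreal ((1 + moment_const n c 2) * mass r ^ (2 * n))"
  proof (cases "n = 0")
    case True
    have "F \<omega> \<le> 1" if "\<omega> \<in> space P" for \<omega>
      unfolding F_def using fact_count_le_prod[of n c "\<lambda>_. ball undefined (real r)", OF c _ that] True by simp
    then have "(\<integral>\<^sup>+\<omega>. ennreal ((F \<omega>)\<^sup>2) \<partial>P) \<le> (\<integral>\<^sup>+\<omega>. 1 \<partial>P)"
      by (intro nn_integral_mono) (auto simp: F_def fact_count_nonneg power_le_one)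
    also have "\<dots> \<le> ennreal (1 + moment_const n c 2)" using K by (simp add: emeasure_space_1 ennreal_ge_1)
    finally show ?thesis using True by simp
  next
    case False
    have "(\<integral>\<^sup>+\<omega>. ennreal ((F \<omega>)\<^sup>2) \<partial>P) \<le> (\<integral>\<^sup>+\<omega>. ennreal ((\<Prod>i\<in>{1..n}. real (cnt (c i) (ball undefined (real r)) \<omega>))\<^sup>2) \<partial>P)"
      unfolding F_def by (intro nn_integral_mono ennreal_leI power_mono fact_count_le_prod c fact_count_nonneg) auto
    also have "\<dots> \<le> ennreal (moment_const n c 2 * mass r ^ (2 * n))"
      unfolding mass_def using r False by (intro nn_integral_prod_cnt_le c) (auto simp: mass_def)
    also have "\<dots> \<le> ennreal ((1 + moment_const n c 2) * mass r ^ (2 * n))"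
      using r by (intro ennreal_leI mult_right_mono) auto
    finally show ?thesis .
  qed
  note le = this
  have nn: "0 \<le> (1 + moment_const n c 2) * mass r ^ (2 * n)" using K r by simp
  show i: "integrable P (\<lambda>\<omega>. (F \<omega>)\<^sup>2)"
    using F le by (intro integrableI_bounded) (auto simp: le_less_trans[OF _ ennreal_less_top])
  have "ennreal (\<integral>\<omega>. (F \<omega>)\<^sup>2 \<partial>P) = (\<integral>\<^sup>+\<omega>. ennreal ((F \<omega>)\<^sup>2) \<partial>P)"
    using i by (intro nn_integral_eq_integral[symmetric]) auto
  then have "ennreal (\<integral>\<omega>. (F \<omega>)\<^sup>2 \<partial>P) \<le> ennreal ((1 + moment_const n c 2) * mass r ^ (2 * n))"
    using le by simp
  then show "(\<integral>\<omega>. (F \<omega>)\<^sup>2 \<partial>P) \<le> (1 + moment_const n c 2) * mass r ^ (2 * n)"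
    using nn by (simp add: ennreal_le_iff)
qed

lemma cnt_mean_variance:
  assumes c: "c \<in> C" and B: "B \<in> sets borel" "bounded B" "0 < emeasure \<mu> B"
  defines "m \<equiv> \<alpha> c * measure \<mu> B"
  shows "integrable P (\<lambda>\<omega>. (real (cnt c B \<omega>) - m)\<^sup>2)"
    and "(\<integral>\<omega>. (real (cnt c B \<omega>) - m)\<^sup>2 \<partial>P) = m"
proof -
  have meas [measurable]: "cnt c B \<in> measurable P (count_space UNIV)" using c B by (intro cnt_measurable) auto
  have m: "0 < m" unfolding m_def by (rule rate_pos[OF c B])
  have f: "integrable P (\<lambda>\<omega>. real (falling (cnt c B \<omega>) p))" "(\<integral>\<omega>. real (falling (cnt c B \<omega>) p) \<partial>P) = m ^ p" for p
    using nn_integral_falling_cnt[OF c B, of p] m unfolding m_def[symmetric]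
    by (subst (asm) nn_integral_eq_integrable; simp)+
  have eq: "(real z - m)\<^sup>2 = real (falling z 2) + (1 - 2 * m) * real (falling z 1) + m\<^sup>2" for z
  proof -
    have "real (falling z 2) = real z * (real z - 1)"
      by (cases z) (auto simp: falling_def numeral_2_eq_2 algebra_simps)
    moreover have "falling z 1 = z" by (simp add: falling_def)
    ultimately show ?thesis by (simp add: power2_eq_square algebra_simps)
  qed
  show "integrable P (\<lambda>\<omega>. (real (cnt c B \<omega>) - m)\<^sup>2)"
    unfolding eq using f(1) by (intro Bochner_Integration.integrable_add integrable_mult_right) auto
  have "(\<integral>\<omega>. (real (cnt c B \<omega>) - m)\<^sup>2 \<partial>P) = m ^ 2 + (1 - 2 * m) * m ^ 1 + m\<^sup>2"
    unfolding eq using f(1)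
    by (simp add: f(2) prob_space)
  then show "(\<integral>\<omega>. (real (cnt c B \<omega>) - m)\<^sup>2 \<partial>P) = m" by (simp add: power2_eq_square algebra_simps)
qed

text \<open>On a ball of mass \<open>M\<close> the count of \<open>Suc n\<close> tuples is \<open>F * (N - k)\<close>, where \<open>F\<close> counts \<open>n\<close>-tuples, \<open>N\<close> is
  the number of points of the last colour, and \<open>k\<close> is how often this colour has occurred before. The
  variable \<open>N\<close> has mean and variance \<open>\<alpha> M\<close>, whatever its dependence on \<open>F\<close>, and \<open>F\<close> is of order \<open>M ^ n\<close>
  in mean square. Replacing \<open>N\<close> by its mean thus changes the expectation by an error of order
  \<open>M ^ n * sqrt M\<close>, which is negligible against \<open>M ^ Suc n\<close> as \<open>M\<close> tends to infinity. Here the infinite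
  total mass of \<open>\<mu>\<close> enters.\<close>

lemma coefficient_recursion:
  assumes c: "\<And>i. i \<in> {1..Suc n} \<Longrightarrow> c i \<in> C" and a: "0 \<le> a"  and b: "0 \<le> b"
    and A: "\<And>r. (\<integral>\<^sup>+\<omega>. ennreal (fact_count (Suc n) c (\<lambda>_. ball undefined (real r)) \<omega>) \<partial>P) = ennreal (a * mass r ^ Suc n)"
    and B: "\<And>r. (\<integral>\<^sup>+\<omega>. ennreal (fact_count n c (\<lambda>_. ball undefined (real r)) \<omega>) \<partial>P) = ennreal (b * mass r ^ n)"
  shows "a = \<alpha> (c (Suc n)) * b"
proof -
  define d where "d = c (Suc n)"
  have d: "d \<in> C" using c by (simp add: d_def)
  define k where "k = real (card {j\<in>{1..n}. c j = c (Suc n)})"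
  define K where "K = (1 + moment_const n c 2 + \<alpha> d) / 2"
  have cn: "\<And>i. i \<in> {1..n} \<Longrightarrow> c i \<in> C" using c by auto
  have bound: "\<bar>a - \<alpha> d * b\<bar> \<le> K / sqrt (mass r) + k * b / mass r" if r: "1 \<le> mass r" for r
  proof -
    define M where "M = mass r"
    have M: "1 \<le> M" using r by (simp add: M_def)
    define F where "F = fact_count n c (\<lambda>_. ball undefined (real r))"
    define G where "G = fact_count (Suc n) c (\<lambda>_. ball undefined (real r))"
    define X where "X \<omega> = real (cnt d (ball undefined (real r)) \<omega>) - \<alpha> d * M" for \<omega>
    have ball: "ball undefined (real r) \<in> sets borel" "bounded (ball (undefined :: 'a) (real r))"
      "0 < emeasure \<mu> (ball undefined (real r))" using r by (auto simp: emeasure_ball)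
    have Fm [measurable]: "F \<in> borel_measurable P" unfolding F_def by (rule fact_count_measurable[OF cn]) auto
    have Gm [measurable]: "G \<in> borel_measurable P" unfolding G_def by (rule fact_count_measurable[OF c]) auto
    have [measurable]: "cnt d (ball undefined (real r)) \<in> measurable P (count_space UNIV)"
      using d ball by (intro cnt_measurable) auto
    have Xm [measurable]: "X \<in> borel_measurable P" unfolding X_def by measurable
    have F1: "integrable P F" "(\<integral>\<omega>. F \<omega> \<partial>P) = b * M ^ n"
      using B[of r] nn_integral_eq_integrable[OF Fm, of "b * M ^ n"] b M by (auto simp: F_def M_def fact_count_nonneg)
    have G1: "integrable P G" "(\<integral>\<omega>. G \<omega> \<partial>P) = a * M ^ Suc n"
      using A[of r] nn_integral_eq_integrable[OF Gm, of "a * M ^ Suc n"] a M by (auto simp: G_def M_def fact_count_nonneg)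
    have F2: "integrable P (\<lambda>\<omega>. (F \<omega>)\<^sup>2)" "(\<integral>\<omega>. (F \<omega>)\<^sup>2 \<partial>P) \<le> (1 + moment_const n c 2) * M ^ (2 * n)"
      using fact_count_square_le[of n c r, OF cn r] by (auto simp: F_def M_def)
    have X2: "integrable P (\<lambda>\<omega>. (X \<omega>)\<^sup>2)" "(\<integral>\<omega>. (X \<omega>)\<^sup>2 \<partial>P) = \<alpha> d * M"
      using cnt_mean_variance[OF d ball] by (auto simp: X_def M_def mass_def)
    have G_eq: "AE \<omega> in P. G \<omega> = F \<omega> * X \<omega> + (\<alpha> d * M - k) * F \<omega>"
      using AE_dissociated_at AE_space
    proof eventually_elim
      case (elim \<omega>)
      have "G \<omega> = F \<omega> * (real (cnt d (ball undefined (real r)) \<omega>) - k)"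
        unfolding G_def F_def d_def k_def by (rule fact_count_Suc[OF c _ elim(2,1)]) auto
      then show ?case by (simp add: X_def algebra_simps)
    qed
    \<comment> \<open>This weight balances the two terms of the arithmetic-geometric mean inequality.\<close>
    define t where "t = sqrt M / M ^ n"
    have t: "0 < t" using M by (simp add: t_def)
    have amgm: "\<bar>F \<omega> * X \<omega>\<bar> \<le> (t * (F \<omega>)\<^sup>2 + (X \<omega>)\<^sup>2 / t) / 2" for \<omega>
    proof -
      have "0 \<le> (t * \<bar>F \<omega>\<bar> - \<bar>X \<omega>\<bar>)\<^sup>2" by simp
      then have "2 * t * \<bar>F \<omega> * X \<omega>\<bar> \<le> t\<^sup>2 * (F \<omega>)\<^sup>2 + (X \<omega>)\<^sup>2"
        by (simp add: power2_diff power_mult_distrib abs_mult)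
      then show ?thesis using t by (simp add: field_simps power2_eq_square)
    qed
    have int: "integrable P (\<lambda>\<omega>. (t * (F \<omega>)\<^sup>2 + (X \<omega>)\<^sup>2 / t) / 2)" using F2(1) X2(1) by auto
    have FX: "integrable P (\<lambda>\<omega>. F \<omega> * X \<omega>)"
      by (rule Bochner_Integration.integrable_bound[OF int]) (use amgm in \<open>auto intro: order_trans[OF _ abs_ge_self]\<close>)
    have "\<bar>\<integral>\<omega>. F \<omega> * X \<omega> \<partial>P\<bar> \<le> (\<integral>\<omega>. \<bar>F \<omega> * X \<omega>\<bar> \<partial>P)" by (rule integral_abs_bound)
    also have "\<dots> \<le> (\<integral>\<omega>. (t * (F \<omega>)\<^sup>2 + (X \<omega>)\<^sup>2 / t) / 2 \<partial>P)"
      using FX int amgm by (intro integral_mono) auto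
    also have "\<dots> = (t * (\<integral>\<omega>. (F \<omega>)\<^sup>2 \<partial>P) + \<alpha> d * M / t) / 2"
      using F2(1) X2 by simp
    also have "\<dots> \<le> (t * ((1 + moment_const n c 2) * M ^ (2 * n)) + \<alpha> d * M / t) / 2"
      using F2(2) t by simp
    also have "\<dots> = K * (sqrt M * M ^ n)"
    proof -
      have "t * M ^ (2 * n) = sqrt M * M ^ n" using M by (simp add: t_def mult_2 power_add)
      moreover have "M / t = sqrt M * M ^ n"
        using M by (simp add: t_def real_div_sqrt field_simps flip: real_sqrt_mult)
      moreover have "(t * ((1 + moment_const n c 2) * M ^ (2 * n)) + \<alpha> d * M / t) / 2
          = ((1 + moment_const n c 2) * (t * M ^ (2 * n)) + \<alpha> d * (M / t)) / 2" by simp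
      ultimately show ?thesis
        unfolding K_def by (simp add: algebra_simps add_divide_distrib)
    qed
    finally have FX_le: "\<bar>\<integral>\<omega>. F \<omega> * X \<omega> \<partial>P\<bar> \<le> K * (sqrt M * M ^ n)" .
    have "a * M ^ Suc n = (\<integral>\<omega>. F \<omega> * X \<omega> + (\<alpha> d * M - k) * F \<omega> \<partial>P)"
      unfolding G1(2)[symmetric] using G_eq by (intro integral_cong_AE) auto
    also have "\<dots> = (\<integral>\<omega>. F \<omega> * X \<omega> \<partial>P) + (\<alpha> d * M - k) * (b * M ^ n)"
      using FX F1 by simp
    finally have eq: "(a - \<alpha> d * b) * (M * M ^ n) = (\<integral>\<omega>. F \<omega> * X \<omega> \<partial>P) - k * b * M ^ n"
      by (simp add: algebra_simps)
    have kb: "0 \<le> k * b * M ^ n" using M b by (simp add: k_def)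
    have "\<bar>a - \<alpha> d * b\<bar> * (M * M ^ n) = \<bar>(a - \<alpha> d * b) * (M * M ^ n)\<bar>" using M by (simp add: abs_mult)
    also have "\<dots> \<le> K * (sqrt M * M ^ n) + k * b * M ^ n" unfolding eq using FX_le kb by linarith
    also have "\<dots> = (K / sqrt M + k * b / M) * (M * M ^ n)"
    proof -
      have "M = sqrt M * sqrt M" using M by simp
      then have "K / sqrt M * M = K * sqrt M" using M by (metis nonzero_eq_divide_eq not_one_le_zero real_sqrt_eq_zero_cancel_iff mult.assoc times_divide_eq_left)
      then have "K / sqrt M * (M * M ^ n) = K * (sqrt M * M ^ n)" by (metis mult.assoc)
      moreover have "k * b / M * (M * M ^ n) = k * b * M ^ n" using M by simp
      ultimately show ?thesis by (simp only: distrib_right)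
    qed
    finally have "\<bar>a - \<alpha> d * b\<bar> \<le> K / sqrt M + k * b / M"
      by (rule mult_right_le_imp_le) (use M in simp)
    then show ?thesis by (simp add: M_def)
  qed
  have "((\<lambda>r. K / sqrt (mass r) + k * b / mass r) \<longlongrightarrow> 0 + 0) sequentially"
    by (intro tendsto_add tendsto_divide_0[OF tendsto_const] filterlim_at_top_imp_at_infinity
        filterlim_compose[OF sqrt_at_top] mass_at_top)
  moreover have "eventually (\<lambda>r. \<bar>a - \<alpha> d * b\<bar> \<le> K / sqrt (mass r) + k * b / mass r) sequentially"
  proof -
    have "eventually (\<lambda>r. 1 \<le> mass r) sequentially" using mass_at_top unfolding filterlim_at_top by blast
    then show ?thesis by eventually_elim (rule bound)
  qed
  ultimately have "\<bar>a - \<alpha> d * b\<bar> \<le> 0 + 0"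
    by (intro tendsto_lowerbound) auto
  then show ?thesis by (simp add: d_def)
qed

lemma nn_integral_fact_count_eq:
  assumes c: "\<And>i. i \<in> {1..n} \<Longrightarrow> c i \<in> C" and B: "\<And>d. d \<in> C \<Longrightarrow> B d \<in> sets borel" "\<And>d. d \<in> C \<Longrightarrow> bounded (B d)"
  shows "(\<integral>\<^sup>+\<omega>. ennreal (fact_count n c B \<omega>) \<partial>P) = ennreal (\<Prod>i\<in>{1..n}. \<alpha> (c i) * measure \<mu> (B (c i)))"
  using assms
proof (induction n arbitrary: B)
  case 0
  then show ?case by (simp add: fact_count_def inj_tuples_0 emeasure_space_1)
next
  case (Suc n)
  have cn: "\<And>i. i \<in> {1..n} \<Longrightarrow> c i \<in> C" using Suc.prems(1) by auto
  obtain a where a: "0 \<le> a" and aB: "\<And>B. (\<forall>d\<in>C. B d \<in> sets borel \<and> bounded (B d)) \<Longrightarrow>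
    (\<integral>\<^sup>+\<omega>. ennreal (fact_count (Suc n) c B \<omega>) \<partial>P) = ennreal (a * (\<Prod>i\<in>{1..Suc n}. measure \<mu> (B (c i))))"
    using fact_count_moment_exists[of "Suc n" c] Suc.prems(1) by blast
  let ?b = "\<Prod>i\<in>{1..n}. \<alpha> (c i)"
  have "a = \<alpha> (c (Suc n)) * ?b"
  proof (rule coefficient_recursion[of n c])
    show "0 \<le> ?b" using cn pos by (intro prod_nonneg) (auto simp: less_imp_le)
    show "(\<integral>\<^sup>+\<omega>. ennreal (fact_count (Suc n) c (\<lambda>_. ball undefined (real r)) \<omega>) \<partial>P) = ennreal (a * mass r ^ Suc n)" for r
      using aB[of "\<lambda>_. ball undefined (real r)"] by (simp add: mass_def)
    show "(\<integral>\<^sup>+\<omega>. ennreal (fact_count n c (\<lambda>_. ball undefined (real r)) \<omega>) \<partial>P) = ennreal (?b * mass r ^ n)" for r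
      using Suc.IH[OF cn, of "\<lambda>_. ball undefined (real r)"] by (simp add: prod.distrib mass_def)
  qed (use Suc.prems a in auto)
  then show ?case
    using aB[of B] Suc.prems(2,3) by (simp add: prod.distrib mult_ac)
qed

section \<open>Void probabilities and independence\<close>

text \<open>Let \<open>Z\<close> be the total number of points that the processes have in their sets. Its \<open>n\<close>-th factorial
  moment is the sum of the factorial moments over all colourings of \<open>n\<close> indices, that is \<open>l ^ n\<close>, so \<open>Z\<close>
  has the factorial moments of a Poisson variable and vanishes with probability \<open>exp (- l)\<close>.\<close>

lemma prob_void:
  assumes B: "\<And>c. c \<in> C \<Longrightarrow> B c \<in> sets borel" "\<And>c. c \<in> C \<Longrightarrow> bounded (B c)"
  shows "prob {\<omega>\<in>space P. \<forall>c\<in>C. N c \<omega> \<inter> B c = {}} = exp (- (\<Sum>c\<in>C. \<alpha> c * measure \<mu> (B c)))"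
proof -
  define l where "l = (\<Sum>c\<in>C. \<alpha> c * measure \<mu> (B c))"
  have l: "0 \<le> l" unfolding l_def using pos by (intro sum_nonneg mult_nonneg_nonneg) (auto simp: less_imp_le)
  define Z where "Z \<omega> = (\<Sum>c\<in>C. cnt c (B c) \<omega>)" for \<omega>
  have m: "cnt c (B c) \<in> measurable P (count_space UNIV)" if "c \<in> C" for c
    using that B by (intro cnt_measurable) auto
  have Zm [measurable]: "Z \<in> measurable P (count_space UNIV)"
    unfolding Z_def by (rule measurable_sum_nat) (use m in auto)
  have nn: "(\<integral>\<^sup>+\<omega>. ennreal (real (falling (Z \<omega>) n)) \<partial>P) = ennreal (l ^ n)" for n
  proof -
    have cC: "c i \<in> C" if "c \<in> PiE {1..n} (\<lambda>_. C)" "i \<in> {1..n}" for c :: "nat \<Rightarrow> nat" and i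
      using that by (rule PiE_mem)
    have "AE \<omega> in P. ennreal (real (falling (Z \<omega>) n)) = (\<Sum>c\<in>PiE {1..n} (\<lambda>_. C). ennreal (fact_count n c B \<omega>))"
      using AE_dissociated_at AE_space
    proof eventually_elim
      case (elim \<omega>)
      have "disjoint_family_on (\<lambda>c. N c \<omega> \<inter> B c) C"
        using dissociated_at_disjoint[OF elim(1)] by (fastforce simp: disjoint_family_on_def)
      then have "(\<Sum>c \<in> PiE {1..n} (\<lambda>_. C). card (inj_tuples n (\<lambda>i. N (c i) \<omega> \<inter> B (c i)))) = falling (Z \<omega>) n"
        unfolding Z_def cnt_def using elim(2) B by (intro sum_card_coloured_inj_tuples finite_C finite_N) auto
      then have "real (falling (Z \<omega>) n) = (\<Sum>c\<in>PiE {1..n} (\<lambda>_. C). fact_count n c B \<omega>)"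
        unfolding fact_count_def of_nat_sum[symmetric] by (simp only:)
      then show ?case by (simp add: sum_ennreal fact_count_nonneg)
    qed
    then have "(\<integral>\<^sup>+\<omega>. ennreal (real (falling (Z \<omega>) n)) \<partial>P) = (\<integral>\<^sup>+\<omega>. (\<Sum>c\<in>PiE {1..n} (\<lambda>_. C). ennreal (fact_count n c B \<omega>)) \<partial>P)"
      by (rule nn_integral_cong_AE)
    also have "\<dots> = (\<Sum>c\<in>PiE {1..n} (\<lambda>_. C). \<integral>\<^sup>+\<omega>. ennreal (fact_count n c B \<omega>) \<partial>P)"
      using B cC by (intro nn_integral_sum measurable_compose[OF fact_count_measurable]) auto
    also have "\<dots> = (\<Sum>c\<in>PiE {1..n} (\<lambda>_. C). ennreal (\<Prod>i\<in>{1..n}. \<alpha> (c i) * measure \<mu> (B (c i))))"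
      using B cC by (intro sum.cong refl nn_integral_fact_count_eq) auto
    also have "\<dots> = ennreal (\<Sum>c\<in>PiE {1..n} (\<lambda>_. C). \<Prod>i\<in>{1..n}. \<alpha> (c i) * measure \<mu> (B (c i)))"
      using pos cC by (intro sum_ennreal prod_nonneg mult_nonneg_nonneg) (auto simp: less_imp_le)
    also have "(\<Sum>c\<in>PiE {1..n} (\<lambda>_. C). \<Prod>i\<in>{1..n}. \<alpha> (c i) * measure \<mu> (B (c i))) = l ^ n"
      using prod_sum_PiE[of "{1..n}" "\<lambda>_. C" "\<lambda>_ c. \<alpha> c * measure \<mu> (B c)"] finite_C by (simp add: l_def)
    finally show ?thesis .
  qed
  have fm: "(\<lambda>\<omega>. real (falling (Z \<omega>) n)) \<in> borel_measurable P" for n by measurable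
  have f: "integrable P (\<lambda>\<omega>. real (falling (Z \<omega>) n))" "(\<integral>\<omega>. real (falling (Z \<omega>) n) \<partial>P) = l ^ n" for n
    using nn[of n] nn_integral_eq_integrable[OF fm[of n], of "l ^ n"] l by auto
  let ?f = "\<lambda>n \<omega>. (-1) ^ n / fact n * real (falling (Z \<omega>) n)"
  have sum_exp: "(\<lambda>n. x ^ n / fact n) sums exp x" for x :: real
    using exp_converges[of x] by (simp add: divide_inverse mult.commute)
  have "(\<lambda>n. \<integral>\<omega>. ?f n \<omega> \<partial>P) sums (\<integral>\<omega>. (\<Sum>n. ?f n \<omega>) \<partial>P)"
  proof (rule sums_integral)
    show "integrable P (?f n)" for n using f(1) by (rule integrable_mult_right)
    have "summable (\<lambda>n. norm (?f n \<omega>))" for \<omega>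
      by (rule summable_finite[of "{..Z \<omega>}"]) (auto simp: falling_eq_choose binomial_eq_0)
    then show "AE \<omega> in P. summable (\<lambda>n. norm (?f n \<omega>))" by simp
    have "(\<integral>\<omega>. norm (?f n \<omega>) \<partial>P) = l ^ n / fact n" for n
      using f by (simp add: abs_mult power_abs)
    then show "summable (\<lambda>n. \<integral>\<omega>. norm (?f n \<omega>) \<partial>P)" using sum_exp[of l] by (simp add: sums_iff)
  qed
  moreover have "(\<integral>\<omega>. ?f n \<omega> \<partial>P) = (- l) ^ n / fact n" for n
    using f by (simp flip: power_mult_distrib)
  ultimately have "(\<integral>\<omega>. (\<Sum>n. ?f n \<omega>) \<partial>P) = exp (- l)"
    using sum_exp[of "- l"] sums_unique2 by fastforce
  moreover have "(\<Sum>n. ?f n \<omega>) = indicator {\<omega>. Z \<omega> = 0} \<omega>" for \<omega>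
    using alternating_falling_sums[of "Z \<omega>"] by (simp add: sums_iff)
  moreover have "(\<integral>\<omega>. indicator {\<omega>. Z \<omega> = 0} \<omega> \<partial>P) = prob ({\<omega>. Z \<omega> = 0} \<inter> space P)"
    by simp
  moreover have "{\<omega>. Z \<omega> = 0} \<inter> space P = {\<omega>\<in>space P. \<forall>c\<in>C. N c \<omega> \<inter> B c = {}}"
  proof -
    have "Z \<omega> = 0 \<longleftrightarrow> (\<forall>c\<in>C. N c \<omega> \<inter> B c = {})" if "\<omega> \<in> space P" for \<omega>
      using finite_N[OF _ that B(2)] finite_C by (simp add: Z_def cnt_def card_eq_0_iff)
    then show ?thesis by blast
  qed
  ultimately show ?thesis by (simp add: l_def)
qed

lemma subfamily:
  assumes J: "J \<subseteq> C"
  shows "dissociated_poisson_processes P \<mu> T S N \<alpha> J"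
proof (unfold_locales)
  show "finite J" using J finite_C by (rule finite_subset)
  show "0 < \<alpha> c" if "c \<in> J" for c by (rule pos[OF subsetD[OF J that]])
  show "T_point_process \<mu> T P S (N c)" if "c \<in> J" for c by (rule process[OF subsetD[OF J that]])
  show "poisson_process \<mu> (\<alpha> c) P (N c)" if "c \<in> J" for c by (rule poisson[OF subsetD[OF J that]])
  show "dissociated P S (N c) (N d)" if "c \<in> J" "d \<in> J" "c \<noteq> d" for c d
    by (rule dissoc[OF subsetD[OF J that(1)] subsetD[OF J that(2)] that(3)])
qed (fact sets_mu boundedly_finite_mu infinite_mu mpt_T P2 mpt_S)+

text \<open>The void probability of a subfamily is the product of the void probabilities of its members, and void
  events are stable under intersection and generate the configuration algebra.\<close>

theorem indep_processes: "indep_vars (\<lambda>_. configuration_algebra) N C"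
proof -
  define G where "G c = {N c -` V \<inter> space P | V. V \<in> void_events}" for c
  have "indep_sets G C"
  proof (rule indep_setsI)
    have "void_events \<subseteq> sets (configuration_algebra :: 'a set measure)"
      unfolding sets_configuration_algebra_void by auto
    then show "G c \<subseteq> events" if "c \<in> C" for c
      using measurable_sets[OF N_measurable[OF that]] by (auto simp: G_def)
    fix A J assume J: "J \<noteq> {}" "J \<subseteq> C" "finite J" and A: "\<forall>j\<in>J. A j \<in> G j"
    have "\<forall>j\<in>J. \<exists>B. B \<in> sets borel \<and> bounded B \<and> A j = {\<omega>\<in>space P. N j \<omega> \<inter> B = {}}"
    proof
      fix j assume j: "j \<in> J"
      then obtain B where "B \<in> sets borel" "bounded B" "A j = N j -` {\<xi>\<in>configurations. \<xi> \<inter> B = {}} \<inter> space P"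
        using A by (auto simp: G_def void_events_def)
      moreover have "N j -` {\<xi>\<in>configurations. \<xi> \<inter> B = {}} \<inter> space P = {\<omega>\<in>space P. N j \<omega> \<inter> B = {}}"
        using N_configuration j J by auto
      ultimately show "\<exists>B. B \<in> sets borel \<and> bounded B \<and> A j = {\<omega>\<in>space P. N j \<omega> \<inter> B = {}}" by blast
    qed
    from bchoice[OF this] obtain B
      where B0: "\<forall>j\<in>J. B j \<in> sets borel \<and> bounded (B j) \<and> A j = {\<omega>\<in>space P. N j \<omega> \<inter> B j = {}}" ..
    have B: "B j \<in> sets borel" "bounded (B j)" "A j = {\<omega>\<in>space P. N j \<omega> \<inter> B j = {}}" if "j \<in> J" for j
      using B0 that by blast+
    have single: "prob (A j) = exp (- (\<alpha> j * measure \<mu> (B j)))" if j: "j \<in> J" for j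
    proof -
      have "{j} \<subseteq> C" using j J(2) by blast
      from dissociated_poisson_processes.prob_void[OF subfamily[OF this], of B]
      show ?thesis using B(1,2)[OF j] unfolding B(3)[OF j] by simp
    qed
    have "(\<Inter>j\<in>J. A j) = {\<omega>\<in>space P. \<forall>j\<in>J. N j \<omega> \<inter> B j = {}}"
      using J(1) B(3) by auto
    also have "prob \<dots> = exp (- (\<Sum>j\<in>J. \<alpha> j * measure \<mu> (B j)))"
      using dissociated_poisson_processes.prob_void[OF subfamily[OF J(2)], of B] B by simp
    also have "\<dots> = (\<Prod>j\<in>J. exp (- (\<alpha> j * measure \<mu> (B j))))"
      by (simp add: exp_sum[OF J(3)] flip: sum_negf)
    also have "\<dots> = (\<Prod>j\<in>J. prob (A j))" using single by simp
    finally show "prob (\<Inter>j\<in>J. A j) = (\<Prod>j\<in>J. prob (A j))" .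
  qed
  moreover have "Int_stable (G c)" for c
    unfolding Int_stable_def G_def
  proof safe
    fix V V' :: "'a set set" assume "V \<in> void_events" "V' \<in> void_events"
    then have "V \<inter> V' \<in> void_events" using Int_stable_void_events by (auto simp: Int_stable_def)
    then show "\<exists>V''. N c -` V \<inter> space P \<inter> (N c -` V' \<inter> space P) = N c -` V'' \<inter> space P \<and> V'' \<in> void_events"
      by (intro exI[of _ "V \<inter> V'"]) auto
  qed
  ultimately have "indep_sets (\<lambda>c. sigma_sets (space P) (G c)) C" by (rule indep_sets_sigma)
  moreover have "sigma_sets (space P) (G c) = {N c -` A \<inter> space P | A. A \<in> sets configuration_algebra}" if "c \<in> C" for c
    unfolding G_def sets_configuration_algebra_void
    by (rule sigma_sets_vimage_commute[symmetric]) (use N_configuration[OF that] in auto)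
  ultimately show ?thesis
    unfolding indep_vars_def2 using N_measurable by (simp cong: indep_sets_cong)
qed

end

theorem proposition3p3:
  fixes \<mu> :: "'a::polish_space measure" and T :: "'a \<Rightarrow> 'a"
    and P :: "'w measure" and S :: "'w \<Rightarrow> 'w"
    and N :: "nat \<Rightarrow> 'w \<Rightarrow> 'a set" and \<alpha> :: "nat \<Rightarrow> real" and k :: nat
  assumes "sets \<mu> = sets borel" and "boundedly_finite \<mu>" and "emeasure \<mu> UNIV = \<infinity>"
    and "invertible_mpt \<mu> T" and "conservative \<mu> T" and "ergodic \<mu> T"
    and "property_P1 \<mu> T" and "property_P2 \<mu> T"
    and "prob_space P" and "invertible_mpt P S" and "ergodic P S"
    and "\<And>i. i \<in> {1..k} \<Longrightarrow> 0 < \<alpha> i"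
    and "\<And>i. i \<in> {1..k} \<Longrightarrow> T_point_process \<mu> T P S (N i)"
    and "\<And>i. i \<in> {1..k} \<Longrightarrow> poisson_process \<mu> (\<alpha> i) P (N i)"
    and "\<And>i j. i \<in> {1..k} \<Longrightarrow> j \<in> {1..k} \<Longrightarrow> i \<noteq> j \<Longrightarrow> dissociated P S (N i) (N j)"
  shows "prob_space.indep_vars P (\<lambda>_. configuration_algebra) N {1..k}"
proof -
  interpret prob_space P by fact
  interpret dissociated_poisson_processes P \<mu> T S N \<alpha> "{1..k}"
    by unfold_locales (use assms in auto)
  show ?thesis by (rule indep_processes)
qed

end
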